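(* For $(\mathfrak b,\mathfrak a)\in G^{\mathbb H}_{\mathrm{aff}}=\mathbb H\rtimes\mathbb H^*$ define an operator $\mathbf U_{\mathbb H}(\mathfrak b,\mathfrak a)$ on the right quaternionic Hilbert space $\mathfrak H_{\mathbb H}=L^2_{\mathbb H}(\mathbb H,d\mathfrak x)$ by $$(\mathbf U_{\mathbb H}(\mathfrak b,\mathfrak a)\mathfrak f)(\mathfrak x)=\frac{1}{|\mathfrak a|^{2}}\,\mathfrak f\big(\mathfrak a^{-1}(\mathfrak x-\mathfrak b)\big),\qquad \mathfrak f\in\mathfrak H_{\mathbb H}.$$ Then $\mathbf U_{\mathbb H}$ is a unitary irreducible representation of $G^{\mathbb H}_{\mathrm{aff}}$ on $\mathfrak H_{\mathbb H}$. More precisely, every nonzero vector is cyclic: if $\mathfrak f\in\mathfrak H_{\mathbb H}$ is nonzero and $\mathfrak f'\in\mathfrak H_{\mathbb H}$ satisfies $(\mathbf U_{\mathbb H}(\mathfrak b,\mathfrak a)\mathfrak f\mid\mathfrak f')=0$ for all $(\mathfrak b,\mathfrak a)\in G^{\mathbb H}_{\mathrm{aff}}$, then $\mathfrak f'=0$.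
   Context: $\mathbb H$ is the division algebra of quaternions, $\mathbb H^*$ its multiplicative group of nonzero elements, $|\cdot|$ the quaternionic norm, and $\overline{\mathfrak q}$ the quaternionic conjugate. $\mathbb H$ is identified with $\mathbb R^4$ via the real components of a quaternion, and $d\mathfrak x$ is Lebesgue measure on $\mathbb R^4$. The quaternionic affine group $G^{\mathbb H}_{\mathrm{aff}}=\mathbb H\rtimes\mathbb H^*$ is the set of pairs $(\mathfrak b,\mathfrak a)$, $\mathfrak b\in\mathbb H$, $\mathfrak a\in\mathbb H^*$, with product $(\mathfrak b,\mathfrak a)(\mathfrak b',\mathfrak a')=(\mathfrak b+\mathfrak a\mathfrak b',\mathfrak a\mathfrak a')$. $\mathfrak H_{\mathbb H}=L^2_{\mathbb H}(\mathbb H,d\mathfrak x)$ is the space of (classes of) measurable functions $\mathfrak f:\mathbb H\to\mathbb H$ with $\int_{\mathbb H}|\mathfrak f(\mathfrak x)|^2\,d\mathfrak x<\infty$. It is a right quaternionic Hilbert space with scalar multiplication $(\mathfrak f\mathfrak q)(\mathfrak x)=\mathfrak f(\mathfrak x)\mathfrak q$ and quaternion-valued inner product $(\mathfrak f\mid\mathfrak f')=\int_{\mathbb H}\overline{\mathfrak f(\mathfrak x)}\,\mathfrak f'(\mathfrak x)\,d\mathfrak x$. A unitary operator on it is a right-$\mathbb H$-linear bijection preserving the inner product; a representation is irreducible if the only closed right-$\mathbb H$-linear subspaces invariant under all its operators are $\{0\}$ and the whole space. *)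

theory Defs
  imports "HOL-Analysis.Analysis" "HOL-Algebra.Group"
begin

section \<open>The division algebra of quaternions\<close>

datatype quat = Quat (quat_re: real) (quat_i: real) (quat_j: real) (quat_k: real)

lemma quat_eq_iff:
  "x = y \<longleftrightarrow> quat_re x = quat_re y \<and> quat_i x = quat_i y \<and> quat_j x = quat_j y \<and> quat_k x = quat_k y"
  by (cases x; cases y) simp

instantiation quat :: ring_1
begin

definition zero_quat_def: "0 = Quat 0 0 0 0"
definition one_quat_def: "1 = Quat 1 0 0 0"
definition plus_quat_def:
  "x + y = Quat (quat_re x + quat_re y) (quat_i x + quat_i y) (quat_j x + quat_j y) (quat_k x + quat_k y)"
definition uminus_quat_def:
  "- x = Quat (- quat_re x) (- quat_i x) (- quat_j x) (- quat_k x)"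
definition minus_quat_def:
  "x - y = Quat (quat_re x - quat_re y) (quat_i x - quat_i y) (quat_j x - quat_j y) (quat_k x - quat_k y)"
definition times_quat_def:
  "x * y = Quat
     (quat_re x * quat_re y - quat_i x * quat_i y - quat_j x * quat_j y - quat_k x * quat_k y)
     (quat_re x * quat_i y + quat_i x * quat_re y + quat_j x * quat_k y - quat_k x * quat_j y)
     (quat_re x * quat_j y - quat_i x * quat_k y + quat_j x * quat_re y + quat_k x * quat_i y)
     (quat_re x * quat_k y + quat_i x * quat_j y - quat_j x * quat_i y + quat_k x * quat_re y)"

instance
  by standard
    (simp_all add: quat_eq_iff zero_quat_def one_quat_def plus_quat_def uminus_quat_def
      minus_quat_def times_quat_def algebra_simps)

end

lemma quat_sel_simps [simp]:
  "quat_re 0 = 0" "quat_i 0 = 0" "quat_j 0 = 0" "quat_k 0 = 0"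
  "quat_re 1 = 1" "quat_i 1 = 0" "quat_j 1 = 0" "quat_k 1 = 0"
  "quat_re (x + y) = quat_re x + quat_re y" "quat_i (x + y) = quat_i x + quat_i y"
  "quat_j (x + y) = quat_j x + quat_j y" "quat_k (x + y) = quat_k x + quat_k y"
  "quat_re (x - y) = quat_re x - quat_re y" "quat_i (x - y) = quat_i x - quat_i y"
  "quat_j (x - y) = quat_j x - quat_j y" "quat_k (x - y) = quat_k x - quat_k y"
  "quat_re (- x) = - quat_re x" "quat_i (- x) = - quat_i x"
  "quat_j (- x) = - quat_j x" "quat_k (- x) = - quat_k x"
  by (simp_all add: zero_quat_def one_quat_def plus_quat_def uminus_quat_def minus_quat_def)

lemma quat_times_sel [simp]:
  "quat_re (x * y) = quat_re x * quat_re y - quat_i x * quat_i y - quat_j x * quat_j y - quat_k x * quat_k y"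
  "quat_i (x * y) = quat_re x * quat_i y + quat_i x * quat_re y + quat_j x * quat_k y - quat_k x * quat_j y"
  "quat_j (x * y) = quat_re x * quat_j y - quat_i x * quat_k y + quat_j x * quat_re y + quat_k x * quat_i y"
  "quat_k (x * y) = quat_re x * quat_k y + quat_i x * quat_j y - quat_j x * quat_i y + quat_k x * quat_re y"
  by (simp_all add: times_quat_def)

instantiation quat :: real_vector
begin

definition scaleR_quat_def:
  "scaleR r x = Quat (r * quat_re x) (r * quat_i x) (r * quat_j x) (r * quat_k x)"

instance
  by standard (simp_all add: scaleR_quat_def quat_eq_iff algebra_simps)

end

instantiation quat :: real_inner
begin

definition inner_quat_def:
  "inner x y = quat_re x * quat_re y + quat_i x * quat_i y + quat_j x * quat_j y + quat_k x * quat_k y"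
definition norm_quat_def:
  "norm x = sqrt ((quat_re x)\<^sup>2 + (quat_i x)\<^sup>2 + (quat_j x)\<^sup>2 + (quat_k x)\<^sup>2)"
definition sgn_quat_def: "sgn (x::quat) = x /\<^sub>R norm x"
definition dist_quat_def: "dist (x::quat) y = norm (x - y)"
definition uniformity_quat_def [code del]:
  "(uniformity :: (quat \<times> quat) filter) = (INF e\<in>{0<..}. principal {(x, y). dist x y < e})"
definition open_quat_def [code del]:
  "open (U :: quat set) \<longleftrightarrow> (\<forall>x\<in>U. eventually (\<lambda>(x', y). x' = x \<longrightarrow> y \<in> U) uniformity)"

instance
proof
  fix x y z :: quat and r s :: real
  show "inner x x = 0 \<longleftrightarrow> x = 0"
  proof
    assume "inner x x = 0"
    then have "(quat_re x)\<^sup>2 + (quat_i x)\<^sup>2 + (quat_j x)\<^sup>2 + (quat_k x)\<^sup>2 = 0"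
      by (simp add: inner_quat_def power2_eq_square)
    then show "x = 0"
      by (simp add: quat_eq_iff add_nonneg_eq_0_iff)
  qed (simp add: inner_quat_def)
  show "inner x y = inner y x"
    by (simp add: inner_quat_def mult.commute)
  show "inner (x + y) z = inner x z + inner y z"
    by (simp add: inner_quat_def distrib_right)
  show "inner (r *\<^sub>R x) y = r * inner x y"
    by (simp add: inner_quat_def scaleR_quat_def distrib_left mult.assoc)
  show "0 \<le> inner x x"
    by (simp add: inner_quat_def)
  show "norm x = sqrt (inner x x)"
    by (simp add: inner_quat_def norm_quat_def power2_eq_square)
qed (fact sgn_quat_def dist_quat_def uniformity_quat_def open_quat_def)+

end

lemma quat_scaleR_sel [simp]:
  "quat_re (r *\<^sub>R x) = r * quat_re x" "quat_i (r *\<^sub>R x) = r * quat_i x"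
  "quat_j (r *\<^sub>R x) = r * quat_j x" "quat_k (r *\<^sub>R x) = r * quat_k x"
  by (simp_all add: scaleR_quat_def)

definition quat_cnj :: "quat \<Rightarrow> quat" where
  "quat_cnj x = Quat (quat_re x) (- quat_i x) (- quat_j x) (- quat_k x)"

lemma quat_cnj_sel [simp]:
  "quat_re (quat_cnj x) = quat_re x" "quat_i (quat_cnj x) = - quat_i x"
  "quat_j (quat_cnj x) = - quat_j x" "quat_k (quat_cnj x) = - quat_k x"
  by (simp_all add: quat_cnj_def)

lemma quat_norm_power2:
  "(norm (x::quat))\<^sup>2 = (quat_re x)\<^sup>2 + (quat_i x)\<^sup>2 + (quat_j x)\<^sup>2 + (quat_k x)\<^sup>2"
  by (simp add: norm_quat_def)

lemma quat_norm_cnj [simp]: "norm (quat_cnj x) = norm x"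
  by (simp add: norm_quat_def)

lemma quat_cnj_times: "quat_cnj x * x = (norm x)\<^sup>2 *\<^sub>R 1" "x * quat_cnj x = (norm x)\<^sup>2 *\<^sub>R 1"
  unfolding quat_norm_power2 by (simp_all add: quat_eq_iff power2_eq_square algebra_simps)

instantiation quat :: real_normed_div_algebra
begin

definition inverse_quat_def: "inverse x = quat_cnj x /\<^sub>R (norm x)\<^sup>2"
definition divide_quat_def: "x div y = x * inverse (y::quat)"

instance
proof
  fix x y :: quat and r :: real
  have scale: "r *\<^sub>R x * y = r *\<^sub>R (x * y)" "x * r *\<^sub>R y = r *\<^sub>R (x * y)"
    for r and x y :: quat
    by (simp_all add: quat_eq_iff algebra_simps)
  show "r *\<^sub>R x * y = r *\<^sub>R (x * y)" "x * r *\<^sub>R y = r *\<^sub>R (x * y)"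
    by (fact scale)+
  have "(norm (x * y))\<^sup>2 = (norm x * norm y)\<^sup>2"
    unfolding power_mult_distrib quat_norm_power2 quat_times_sel by algebra
  then show "norm (x * y) = norm x * norm y"
    by (rule power2_eq_imp_eq) simp_all
  show "x div y = x * inverse y"
    by (fact divide_quat_def)
  show "inverse (0::quat) = 0"
    unfolding inverse_quat_def by (simp add: quat_cnj_def zero_quat_def scaleR_quat_def)
  assume "x \<noteq> 0"
  then have n: "inverse ((norm x)\<^sup>2) * (norm x)\<^sup>2 = 1"
    by simp
  show "inverse x * x = 1" "x * inverse x = 1"
    unfolding inverse_quat_def scale quat_cnj_times scaleR_scaleR n by (rule scaleR_one)+
qed

end

instantiation quat :: euclidean_space
begin

definition Basis_quat_def: "Basis = {Quat 1 0 0 0, Quat 0 1 0 0, Quat 0 0 1 0, Quat 0 0 0 1}"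

instance
proof
  show "(Basis :: quat set) \<noteq> {}" "finite (Basis :: quat set)"
    by (simp_all add: Basis_quat_def)
  show "inner u v = (if u = v then 1 else 0)" if "u \<in> Basis" "v \<in> Basis" for u v :: quat
    using that unfolding Basis_quat_def by (elim insertE emptyE) (simp_all add: inner_quat_def)
  show "(\<forall>u\<in>Basis. inner x u = 0) \<longleftrightarrow> x = 0" for x :: quat
    by (simp add: Basis_quat_def inner_quat_def quat_eq_iff[of x 0])
qed

end

lemma DIM_quat [simp]: "DIM(quat) = 4"
  by (simp add: Basis_quat_def)


section \<open>The quaternionic affine group\<close>

definition quat_aff :: "(quat \<times> quat) monoid" where
  "quat_aff = \<lparr>carrier = UNIV \<times> (UNIV - {0}),
     monoid.mult = (\<lambda>(b, a) (b', a'). (b + a * b', a * a')), one = (0, 1)\<rparr>"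

lemma quat_aff_simps [simp]:
  "p \<in> carrier quat_aff \<longleftrightarrow> snd p \<noteq> 0"
  "p \<otimes>\<^bsub>quat_aff\<^esub> q = (fst p + snd p * fst q, snd p * snd q)"
  "\<one>\<^bsub>quat_aff\<^esub> = (0, 1)"
  by (simp_all add: quat_aff_def mem_Times_iff case_prod_beta)

lemma group_quat_aff: "group quat_aff"
proof (rule groupI)
  fix x assume "x \<in> carrier quat_aff"
  then show "\<exists>y\<in>carrier quat_aff. y \<otimes>\<^bsub>quat_aff\<^esub> x = \<one>\<^bsub>quat_aff\<^esub>"
    by (intro bexI[of _ "(- (inverse (snd x) * fst x), inverse (snd x))"]) simp_all
qed (simp_all add: distrib_left mult.assoc add.assoc)


section \<open>Lebesgue measure under the affine action\<close>

lemma nn_integral_quat_translate: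
  fixes f :: "quat \<Rightarrow> ennreal"
  assumes [measurable]: "f \<in> borel_measurable borel"
  shows "(\<integral>\<^sup>+x. f (t + x) \<partial>lborel) = (\<integral>\<^sup>+x. f x \<partial>lborel)"
proof -
  have "(\<integral>\<^sup>+x. f x \<partial>lborel) = (\<integral>\<^sup>+x. f x \<partial>distr lborel borel ((+) t))"
    by (simp add: lborel_distr_plus)
  also have "\<dots> = (\<integral>\<^sup>+x. f (t + x) \<partial>lborel)"
    by (subst nn_integral_distr) auto
  finally show ?thesis ..
qed

lemma nn_integral_quat_reflect:
  fixes f :: "quat \<Rightarrow> ennreal"
  assumes [measurable]: "f \<in> borel_measurable borel"
  shows "(\<integral>\<^sup>+x. f (t - x) \<partial>lborel) = (\<integral>\<^sup>+x. f x \<partial>lborel)"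
proof -
  have "(\<integral>\<^sup>+x. f x \<partial>lborel) = (\<integral>\<^sup>+x. f x \<partial>distr lborel borel (\<lambda>x. t + (-1) *\<^sub>R x))"
    by (subst lborel_affine[of "-1" t]) (simp_all add: density_1)
  also have "\<dots> = (\<integral>\<^sup>+x. f (t - x) \<partial>lborel)"
    by (subst nn_integral_distr) auto
  finally show ?thesis ..
qed

text \<open>
  Uniqueness of translation-invariant measures: exchanging the order of integration gives
  \<open>\<lambda>(B) \<lambda>(a\<inverse> A) = \<lambda>(a\<inverse> B) \<lambda>(A)\<close>, and the factor is read off from the unit ball \<open>B\<close>.
\<close>

lemma emeasure_quat_mult_left:
  fixes a :: quat
  assumes a: "a \<noteq> 0" and [measurable]: "A \<in> sets borel"
  shows "emeasure lborel {x. a * x \<in> A} = ennreal (1 / norm a ^ 4) * emeasure lborel A"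
proof -
  define B :: "quat set" where "B = ball 0 1"
  have [measurable]: "B \<in> sets borel"
    by (simp add: B_def)
  define V where "V = unit_ball_vol 4"
  have V: "V > 0" unfolding V_def by simp
  have preim: "(\<integral>\<^sup>+x. indicator S (a * x) \<partial>lborel) = emeasure lborel {x. a * x \<in> S}"
    if [measurable]: "S \<in> sets borel" for S :: "quat set"
  proof -
    have "(\<integral>\<^sup>+x. indicator S (a * x) \<partial>lborel) = (\<integral>\<^sup>+x. indicator {x. a * x \<in> S} x \<partial>lborel)"
      by (simp add: indicator_def)
    also have "\<dots> = emeasure lborel {x. a * x \<in> S}"
      by (rule nn_integral_indicator) measurable
    finally show ?thesis .
  qed
  have "emeasure lborel {x. a * x \<in> A} * emeasure lborel B
      = (\<integral>\<^sup>+x. (\<integral>\<^sup>+y. indicator A (a * x) * indicator B y \<partial>lborel) \<partial>lborel)"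
    by (simp add: nn_integral_cmult nn_integral_multc preim)
  also have "\<dots> = (\<integral>\<^sup>+x. (\<integral>\<^sup>+y. indicator A (a * x) * indicator B (a * x + y) \<partial>lborel) \<partial>lborel)"
    by (rule nn_integral_cong, rule nn_integral_quat_translate[symmetric]) measurable
  also have "\<dots> = (\<integral>\<^sup>+y. (\<integral>\<^sup>+x. indicator A (a * x) * indicator B (a * x + y) \<partial>lborel) \<partial>lborel)"
    by (rule lborel_pair.Fubini') measurable
  also have "\<dots> = (\<integral>\<^sup>+y. (\<integral>\<^sup>+x. indicator A (a * x - y) * indicator B (a * x) \<partial>lborel) \<partial>lborel)"
  proof (rule nn_integral_cong)
    fix y :: quat
    have "(\<integral>\<^sup>+x. indicator A (a * x) * indicator B (a * x + y) \<partial>lborel) =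
      (\<integral>\<^sup>+x. indicator A (a * (- (inverse a * y) + x)) * indicator B (a * (- (inverse a * y) + x) + y) \<partial>lborel)"
      by (rule nn_integral_quat_translate[symmetric]) measurable
    also have "\<dots> = (\<integral>\<^sup>+x. indicator A (a * x - y) * indicator B (a * x) \<partial>lborel)"
    proof -
      have "a * (- (inverse a * y) + x) = a * x - y" for x
      proof -
        have "a * (inverse a * y) = y"
          by (simp only: mult.assoc[symmetric] right_inverse[OF a] mult_1_left)
        then show ?thesis
          by (simp only: distrib_left mult_minus_right) simp
      qed
      then show ?thesis by simp
    qed
    finally show "(\<integral>\<^sup>+x. indicator A (a * x) * indicator B (a * x + y) \<partial>lborel) =
      (\<integral>\<^sup>+x. indicator A (a * x - y) * indicator B (a * x) \<partial>lborel :: ennreal)" .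
  qed
  also have "\<dots> = (\<integral>\<^sup>+x. (\<integral>\<^sup>+y. indicator A (a * x - y) * indicator B (a * x) \<partial>lborel) \<partial>lborel)"
    by (rule lborel_pair.Fubini') measurable
  also have "\<dots> = (\<integral>\<^sup>+x. (\<integral>\<^sup>+y. indicator A y * indicator B (a * x) \<partial>lborel) \<partial>lborel)"
    by (rule nn_integral_cong, rule nn_integral_quat_reflect) measurable
  also have "\<dots> = emeasure lborel A * emeasure lborel {x. a * x \<in> B}"
    by (simp add: nn_integral_cmult nn_integral_multc preim)
  also have "{x. a * x \<in> B} = ball 0 (1 / norm a)"
    using a by (simp add: set_eq_iff B_def norm_mult pos_less_divide_eq mult.commute)
  also have "emeasure lborel (ball (0::quat) (1 / norm a)) = ennreal (V * (1 / norm a) ^ 4)"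
    by (simp add: emeasure_ball V_def)
  also have "\<dots> = ennreal V * ennreal (1 / norm a ^ 4)"
    using V by (subst ennreal_mult'[symmetric]) (simp_all add: power_divide)
  also have "emeasure lborel B = ennreal V"
    by (simp add: emeasure_ball V_def B_def)
  finally have "ennreal V * emeasure lborel {x. a * x \<in> A} =
      ennreal V * (ennreal (1 / norm a ^ 4) * emeasure lborel A)"
    by (simp only: mult_ac)
  moreover have "ennreal V \<noteq> 0" "ennreal V \<noteq> Orderings.top"
    using V by simp_all
  ultimately show ?thesis
    by (simp only: ennreal_mult_cancel_left) blast
qed

lemma distr_lborel_quat_affine:
  fixes a b :: quat
  assumes a: "a \<noteq> 0"
  shows "distr lborel borel (\<lambda>x. inverse a * (x - b)) = density lborel (\<lambda>_. ennreal (norm a ^ 4))"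
proof (rule measure_eqI)
  fix A :: "quat set" assume "A \<in> sets (distr lborel borel (\<lambda>x. inverse a * (x - b)))"
  then have A[measurable]: "A \<in> sets borel" by simp
  let ?S = "{x. inverse a * x \<in> A}"
  have [measurable]: "?S \<in> sets borel" by measurable
  have "emeasure (distr lborel borel (\<lambda>x. inverse a * (x - b))) A
      = emeasure lborel ((\<lambda>x. inverse a * (x - b)) -` A)"
    by (subst emeasure_distr) auto
  also have "(\<lambda>x. inverse a * (x - b)) -` A = (\<lambda>x. - b + x) -` ?S"
    by auto
  also have "emeasure lborel \<dots> = emeasure (distr lborel borel ((+) (- b))) ?S"
    by (subst emeasure_distr) auto
  also have "\<dots> = emeasure lborel ?S"
    by (simp add: lborel_distr_plus)
  also have "\<dots> = ennreal (norm a ^ 4) * emeasure lborel A"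
    using emeasure_quat_mult_left[of "inverse a" A] a by (simp add: norm_inverse power_inverse inverse_eq_divide[symmetric])
  finally show "emeasure (distr lborel borel (\<lambda>x. inverse a * (x - b))) A
      = emeasure (density lborel (\<lambda>_. ennreal (norm a ^ 4))) A"
    by (simp add: emeasure_density_const)
qed simp


section \<open>The space of square-integrable quaternion-valued functions\<close>

text \<open>
  Borel measurability loses nothing: every Lebesgue-measurable function agrees almost everywhere
  with a Borel one, so the classes below are the same.
\<close>

definition sq_integrable :: "(quat \<Rightarrow> quat) \<Rightarrow> bool" where
  "sq_integrable f \<longleftrightarrow> f \<in> borel_measurable lborel \<and> integrable lborel (\<lambda>x. (norm (f x))\<^sup>2)"

definition l2_eq :: "(quat \<Rightarrow> quat) \<Rightarrow> (quat \<Rightarrow> quat) \<Rightarrow> bool" where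
  "l2_eq f g \<longleftrightarrow> sq_integrable f \<and> sq_integrable g \<and> (AE x in lborel. f x = g x)"

lemma AE_eq_add:
  "AE x in M. f x = f' x \<Longrightarrow> AE x in M. g x = g' x \<Longrightarrow> AE x in M. f x + g x = f' x + g' x"
  by (elim AE_mp) (auto intro!: AE_I2)

lemma AE_eq_scaleR: "AE x in M. f x = g x \<Longrightarrow> AE x in M. r *\<^sub>R f x = r *\<^sub>R g x"
  by (elim AE_mp) (auto intro!: AE_I2)

lemma AE_eq_mult_right: "AE x in M. f x = g x \<Longrightarrow> AE x in M. f x * q = g x * q"
  by (elim AE_mp) (auto intro!: AE_I2)

lemma l2_eqI: "sq_integrable f \<Longrightarrow> (\<And>x. f x = g x) \<Longrightarrow> l2_eq f g"
proof -
  assume "sq_integrable f" "\<And>x. f x = g x"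
  moreover from this(2) have "f = g" by (rule ext)
  ultimately show "l2_eq f g" by (simp add: l2_eq_def)
qed

lemma l2_eq_sq_integrable: "l2_eq f f \<Longrightarrow> sq_integrable f"
  by (simp add: l2_eq_def)

lemma sq_integrable_measurable: "sq_integrable f \<Longrightarrow> f \<in> borel_measurable borel"
  by (simp add: sq_integrable_def)

lemma sq_integrable_zero: "sq_integrable (\<lambda>_. 0)"
  by (simp add: sq_integrable_def)

lemma sq_integrable_add:
  assumes "sq_integrable f" "sq_integrable g"
  shows "sq_integrable (\<lambda>x. f x + g x)"
proof -
  have [measurable]: "f \<in> borel_measurable borel" "g \<in> borel_measurable borel"
    using assms by (auto intro: sq_integrable_measurable)
  have "integrable lborel (\<lambda>x. (norm (f x + g x))\<^sup>2)"
  proof (rule Bochner_Integration.integrable_bound)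
    show "integrable lborel (\<lambda>x. 2 * (norm (f x))\<^sup>2 + 2 * (norm (g x))\<^sup>2)"
      using assms by (simp add: sq_integrable_def)
    have "(norm (f x + g x))\<^sup>2 \<le> 2 * (norm (f x))\<^sup>2 + 2 * (norm (g x))\<^sup>2" for x
    proof -
      have "(norm (f x + g x))\<^sup>2 \<le> (norm (f x) + norm (g x))\<^sup>2"
        by (intro power_mono norm_triangle_ineq) auto
      also have "\<dots> \<le> 2 * (norm (f x))\<^sup>2 + 2 * (norm (g x))\<^sup>2"
        using sum_squares_bound[of "norm (f x)" "norm (g x)"] by (simp add: power2_sum)
      finally show ?thesis .
    qed
    then show "AE x in lborel. norm ((norm (f x + g x))\<^sup>2) \<le> norm (2 * (norm (f x))\<^sup>2 + 2 * (norm (g x))\<^sup>2)"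
      by (intro AE_I2) simp
  qed measurable
  then show ?thesis
    by (simp add: sq_integrable_def)
qed

lemma sq_integrable_scaleR: "sq_integrable f \<Longrightarrow> sq_integrable (\<lambda>x. r *\<^sub>R f x)"
  by (auto simp: sq_integrable_def power_mult_distrib)

lemma sq_integrable_mult_right: "sq_integrable f \<Longrightarrow> sq_integrable (\<lambda>x. f x * q)"
  by (auto simp: sq_integrable_def power_mult_distrib norm_mult)

lemma sq_integrable_affine:
  assumes "sq_integrable f" and a: "a \<noteq> 0"
  shows "sq_integrable (\<lambda>x. f (inverse a * (x - b)))"
proof -
  have [measurable]: "f \<in> borel_measurable borel"
    using assms by (auto intro: sq_integrable_measurable)
  have "integrable (density lborel (\<lambda>_. ennreal (norm a ^ 4))) (\<lambda>x. (norm (f x))\<^sup>2)"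
    using assms by (subst integrable_density) (auto simp: sq_integrable_def)
  then have "integrable lborel (\<lambda>x. (norm (f (inverse a * (x - b))))\<^sup>2)"
    unfolding distr_lborel_quat_affine[OF a, of b, symmetric] by (subst (asm) integrable_distr_eq) auto
  then show ?thesis
    by (simp add: sq_integrable_def)
qed

lemma AE_quat_affine:
  fixes f g :: "quat \<Rightarrow> quat"
  assumes [measurable]: "f \<in> borel_measurable borel" "g \<in> borel_measurable borel"
    and "AE x in lborel. f x = g x" and a: "a \<noteq> 0"
  shows "AE x in lborel. f (inverse a * (x - b)) = g (inverse a * (x - b))"
proof -
  have "AE x in density lborel (\<lambda>_. ennreal (norm a ^ 4)). f x = g x"
    using assms by (subst AE_density) auto
  then show ?thesis
    unfolding distr_lborel_quat_affine[OF a, of b, symmetric] by (subst (asm) AE_distr_iff) auto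
qed

quotient_type l2_quat = "quat \<Rightarrow> quat" / partial: l2_eq
proof (rule part_equivpI)
  show "\<exists>f. l2_eq f f"
    by (rule exI[of _ "\<lambda>_. 0"]) (simp add: l2_eq_def sq_integrable_zero)
  show "symp l2_eq"
    by (auto simp: symp_def l2_eq_def)
  show "transp l2_eq"
    by (auto simp: transp_def l2_eq_def)
qed

text \<open>The factor on the right is the scalar, matching the right-linear structure.\<close>

lift_definition rscale :: "l2_quat \<Rightarrow> quat \<Rightarrow> l2_quat" is "\<lambda>f q x. f x * q"
  unfolding l2_eq_def by (blast intro: sq_integrable_mult_right AE_eq_mult_right)

lemma quat_cnj_measurable [measurable]: "quat_cnj \<in> borel_measurable borel"
proof -
  have "linear quat_cnj"
    by (rule linearI) (simp_all add: quat_eq_iff)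
  then show ?thesis
    by (intro borel_measurable_continuous_onI linear_continuous_on) (simp add: linear_conv_bounded_linear)
qed

lift_definition qinner :: "l2_quat \<Rightarrow> l2_quat \<Rightarrow> quat" is
  "\<lambda>f g. \<integral>x. quat_cnj (f x) * g x \<partial>lborel"
proof -
  fix f f' g g' assume *: "l2_eq f f'" "l2_eq g g'"
  then have [measurable]: "f \<in> borel_measurable borel" "g \<in> borel_measurable borel"
     "f' \<in> borel_measurable borel" "g' \<in> borel_measurable borel"
    by (auto simp: l2_eq_def sq_integrable_def)
  show "(\<integral>x. quat_cnj (f x) * g x \<partial>lborel) = (\<integral>x. quat_cnj (f' x) * g' x \<partial>lborel)"
    using * by (intro integral_cong_AE) (auto simp: l2_eq_def)
qed

lemma sq_integrable_inner:
  assumes "sq_integrable f" "sq_integrable g"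
  shows "integrable lborel (\<lambda>x. quat_cnj (f x) * g x)"
proof (rule Bochner_Integration.integrable_bound)
  show "integrable lborel (\<lambda>x. (norm (f x))\<^sup>2 + (norm (g x))\<^sup>2)"
    using assms by (simp add: sq_integrable_def)
  have [measurable]: "f \<in> borel_measurable borel" "g \<in> borel_measurable borel"
    using assms by (auto intro: sq_integrable_measurable)
  show "(\<lambda>x. quat_cnj (f x) * g x) \<in> borel_measurable lborel"
    by simp
  have "norm (f x) * norm (g x) \<le> (norm (f x))\<^sup>2 + (norm (g x))\<^sup>2" for x
  proof -
    have "0 \<le> norm (f x) * norm (g x)" by simp
    then show ?thesis
      using sum_squares_bound[of "norm (f x)" "norm (g x)"] by linarith
  qed
  then show "AE x in lborel. norm (quat_cnj (f x) * g x) \<le> norm ((norm (f x))\<^sup>2 + (norm (g x))\<^sup>2)"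
    by (intro AE_I2) (simp add: norm_mult)
qed

instantiation l2_quat :: real_vector
begin

lift_definition zero_l2_quat :: l2_quat is "\<lambda>_. 0"
  by (simp add: l2_eq_def sq_integrable_zero)

lift_definition plus_l2_quat :: "l2_quat \<Rightarrow> l2_quat \<Rightarrow> l2_quat" is "\<lambda>f g x. f x + g x"
  unfolding l2_eq_def by (blast intro: sq_integrable_add AE_eq_add)

lift_definition scaleR_l2_quat :: "real \<Rightarrow> l2_quat \<Rightarrow> l2_quat" is "\<lambda>r f x. r *\<^sub>R f x"
  unfolding l2_eq_def by (blast intro: sq_integrable_scaleR AE_eq_scaleR)

definition uminus_l2_quat_def: "- F = (-1) *\<^sub>R (F :: l2_quat)"
definition minus_l2_quat_def: "F - G = F + (-1) *\<^sub>R (G :: l2_quat)"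

instance
proof
  fix F G H :: l2_quat and r s :: real
  note sq = sq_integrable_add sq_integrable_scaleR sq_integrable_zero l2_eq_sq_integrable
  show "F + G + H = F + (G + H)"
    by transfer (rule l2_eqI, simp_all add: sq add.assoc)
  show "F + G = G + F"
    by transfer (rule l2_eqI, simp_all add: sq add.commute)
  show "0 + F = F"
    by transfer (rule l2_eqI, simp_all add: sq)
  show "- F + F = 0"
    unfolding uminus_l2_quat_def by transfer (rule l2_eqI, simp_all add: sq)
  show "F - G = F + - G"
    by (simp only: uminus_l2_quat_def minus_l2_quat_def)
  show "r *\<^sub>R (F + G) = r *\<^sub>R F + r *\<^sub>R G"
    by transfer (rule l2_eqI, simp_all add: sq scaleR_add_right)
  show "(r + s) *\<^sub>R F = r *\<^sub>R F + s *\<^sub>R F"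
    by transfer (rule l2_eqI, simp_all add: sq scaleR_add_left)
  show "r *\<^sub>R s *\<^sub>R F = (r * s) *\<^sub>R F"
    by transfer (rule l2_eqI, simp_all add: sq)
  show "1 *\<^sub>R F = F"
    by transfer (rule l2_eqI, simp_all add: sq)
qed

end

text \<open>
  The underlying real inner product is the real part of the quaternionic one, so that
  \<open>norm F = sqrt (F | F)\<close>; the topology (hence \<open>closed\<close>) is the one of this norm.
\<close>

lemma quat_re_cnj_times: "quat_re (quat_cnj x * y) = inner x y"
  by (simp add: inner_quat_def)

lemma quat_re_eq_inner: "quat_re x = inner x 1"
  by (simp add: inner_quat_def)

lemma quat_re_integral:
  "integrable M f \<Longrightarrow> quat_re (integral\<^sup>L M f) = (\<integral>x. quat_re (f x) \<partial>M)"
  unfolding quat_re_eq_inner by (rule integral_inner_left[symmetric]) simp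

lemma quat_re_l2_inner:
  assumes "sq_integrable f" "sq_integrable g"
  shows "quat_re (\<integral>x. quat_cnj (f x) * g x \<partial>lborel) = (\<integral>x. inner (f x) (g x) \<partial>lborel)"
  using quat_re_integral[OF sq_integrable_inner[OF assms]] by (simp only: quat_re_cnj_times)

lemma sq_integrable_real_inner:
  assumes "sq_integrable f" "sq_integrable g"
  shows "integrable lborel (\<lambda>x. inner (f x) (g x))"
  unfolding quat_re_cnj_times[symmetric] unfolding quat_re_eq_inner
  by (rule integrable_inner_left) (rule sq_integrable_inner[OF assms])

instantiation l2_quat :: real_inner
begin

definition inner_l2_quat_def: "inner F G = quat_re (qinner F G)"
definition norm_l2_quat_def: "norm F = sqrt (quat_re (qinner F F))"
definition sgn_l2_quat_def: "sgn F = (F :: l2_quat) /\<^sub>R norm F"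
definition dist_l2_quat_def: "dist F G = norm (F - G :: l2_quat)"
definition uniformity_l2_quat_def [code del]:
  "(uniformity :: (l2_quat \<times> l2_quat) filter) = (INF e\<in>{0<..}. principal {(F, G). dist F G < e})"
definition open_l2_quat_def [code del]:
  "open (S :: l2_quat set) \<longleftrightarrow> (\<forall>F\<in>S. eventually (\<lambda>(F', G). F' = F \<longrightarrow> G \<in> S) uniformity)"

instance
proof
  fix F G H :: l2_quat and r s :: real
  show "inner F G = inner G F"
    unfolding inner_l2_quat_def
    by transfer (auto simp: l2_eq_def quat_re_l2_inner inner_commute)
  show "inner (F + G) H = inner F H + inner G H"
    unfolding inner_l2_quat_def
    by transfer (auto simp: l2_eq_def quat_re_l2_inner sq_integrable_add inner_add_left sq_integrable_real_inner)
  show "inner (r *\<^sub>R F) G = r * inner F G"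
    unfolding inner_l2_quat_def
    by transfer (auto simp: l2_eq_def quat_re_l2_inner sq_integrable_scaleR sq_integrable_real_inner)
  show "0 \<le> inner F F"
    unfolding inner_l2_quat_def
    by transfer (auto simp: l2_eq_def quat_re_l2_inner)
  show "inner F F = 0 \<longleftrightarrow> F = 0"
    unfolding inner_l2_quat_def
  proof transfer
    fix f assume "l2_eq f f"
    then have f: "sq_integrable f" by (simp add: l2_eq_def)
    have "(\<integral>x. inner (f x) (f x) \<partial>lborel) = 0 \<longleftrightarrow> (AE x in lborel. inner (f x) (f x) = 0)"
      by (rule integral_nonneg_eq_0_iff_AE) (simp_all add: sq_integrable_real_inner f)
    then show "quat_re (\<integral>x. quat_cnj (f x) * f x \<partial>lborel) = 0 \<longleftrightarrow> l2_eq f (\<lambda>_. 0)"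
      by (simp add: quat_re_l2_inner f l2_eq_def sq_integrable_zero)
  qed
  show "norm F = sqrt (inner F F)"
    by (simp only: inner_l2_quat_def norm_l2_quat_def)
qed (fact sgn_l2_quat_def dist_l2_quat_def uniformity_l2_quat_def open_l2_quat_def)+

end


section \<open>Unitary representations\<close>

definition right_linear :: "(l2_quat \<Rightarrow> l2_quat) \<Rightarrow> bool" where
  "right_linear T \<longleftrightarrow>
     (\<forall>F G. T (F + G) = T F + T G) \<and> (\<forall>F q. T (rscale F q) = rscale (T F) q)"

definition unitary_op :: "(l2_quat \<Rightarrow> l2_quat) \<Rightarrow> bool" where
  "unitary_op T \<longleftrightarrow> right_linear T \<and> bij T \<and> (\<forall>F G. qinner (T F) (T G) = qinner F G)"

definition unitary_representation :: "('g, 'm) monoid_scheme \<Rightarrow> ('g \<Rightarrow> l2_quat \<Rightarrow> l2_quat) \<Rightarrow> bool" where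
  "unitary_representation G U \<longleftrightarrow>
     group G \<and> (\<forall>g\<in>carrier G. unitary_op (U g)) \<and> U \<one>\<^bsub>G\<^esub> = id \<and>
     (\<forall>g\<in>carrier G. \<forall>h\<in>carrier G. U (g \<otimes>\<^bsub>G\<^esub> h) = U g \<circ> U h)"

definition right_subspace :: "l2_quat set \<Rightarrow> bool" where
  "right_subspace S \<longleftrightarrow>
     0 \<in> S \<and> (\<forall>F\<in>S. \<forall>G\<in>S. F + G \<in> S) \<and> (\<forall>F\<in>S. \<forall>q. rscale F q \<in> S)"

definition irreducible_representation :: "('g, 'm) monoid_scheme \<Rightarrow> ('g \<Rightarrow> l2_quat \<Rightarrow> l2_quat) \<Rightarrow> bool" where
  "irreducible_representation G U \<longleftrightarrow>
     (\<forall>S. closed S \<and> right_subspace S \<and> (\<forall>g\<in>carrier G. U g ` S \<subseteq> S) \<longrightarrow> S = {0} \<or> S = UNIV)"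

text \<open>That is, the closed right-linear span of the orbit of \<open>F\<close> is the whole space.\<close>

definition cyclic_vector :: "('g, 'm) monoid_scheme \<Rightarrow> ('g \<Rightarrow> l2_quat \<Rightarrow> l2_quat) \<Rightarrow> l2_quat \<Rightarrow> bool" where
  "cyclic_vector G U F \<longleftrightarrow>
     (\<forall>S. closed S \<and> right_subspace S \<and> (\<forall>g\<in>carrier G. U g F \<in> S) \<longrightarrow> S = UNIV)"


section \<open>The representation of the affine group\<close>

text \<open>For \<open>a = 0\<close>, outside the group, this is the zero operator since \<open>1 / 0 = 0\<close>.\<close>

lift_definition U_aff :: "quat \<times> quat \<Rightarrow> l2_quat \<Rightarrow> l2_quat" is
  "\<lambda>(b, a) f x. (1 / (norm a)\<^sup>2) *\<^sub>R f (inverse a * (x - b))"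
proof -
  fix p :: "quat \<times> quat" and f g assume *: "l2_eq f g"
  obtain b a where p: "p = (b, a)" by (cases p)
  show "l2_eq ((case p of (b, a) \<Rightarrow> \<lambda>f x. (1 / (norm a)\<^sup>2) *\<^sub>R f (inverse a * (x - b))) f)
              ((case p of (b, a) \<Rightarrow> \<lambda>f x. (1 / (norm a)\<^sup>2) *\<^sub>R f (inverse a * (x - b))) g)"
  proof (cases "a = 0")
    case True
    then show ?thesis by (simp add: p l2_eq_def sq_integrable_zero)
  next
    case False
    have f: "sq_integrable f" "sq_integrable g" "AE x in lborel. f x = g x"
      using * by (simp_all add: l2_eq_def)
    then have "AE x in lborel. f (inverse a * (x - b)) = g (inverse a * (x - b))"
      using False by (intro AE_quat_affine sq_integrable_measurable)
    then show ?thesis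
      unfolding p l2_eq_def prod.case
      by (intro conjI sq_integrable_scaleR sq_integrable_affine f False AE_eq_scaleR)
  qed
qed

end

theory Submission
  imports Defs
begin

text \<open>
  Orthogonality of \<open>F'\<close> to the whole orbit of \<open>F\<close> says that the function
  \<open>\<tau>(x, y) = cnj (F x) * F' y\<close> on \<open>\<real>\<^sup>8\<close> has integral zero over every quaternionic line
  \<open>x + c * y = p\<close> with \<open>c \<noteq> 0\<close>. Superposing the lines with weight
  \<open>(t (1 + |c|\<^sup>2) + |p|\<^sup>2)\<^sup>-\<^sup>4\<close> and completing the square in \<open>c\<close> turns this into
  \<open>\<integral> \<tau>(z) (t + |z - z\<^sub>0|\<^sup>2)\<^sup>-\<^sup>2 dz = 0\<close> for all \<open>t > 0\<close> and \<open>z\<^sub>0\<close>. The third difference in \<open>t\<close> of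
  this kernel is positive and integrable, so its rescalings form an approximate identity and
  \<open>\<tau>\<close> vanishes almost everywhere; hence \<open>F\<close> or \<open>F'\<close> is zero.
  Since the quaternionic orthogonal complement of a proper closed right subspace contains a
  nonzero vector, cyclicity and irreducibility follow.
\<close>

section \<open>Integrals over Euclidean space\<close>

text \<open>The exponent 4 of the weight is forced. For B, D > 0 the integral over c in \<real>^4 of
  (B |c|^2 + D)^-m is a constant times B^-2 D^(2-m), and only m = 4 makes it a function of B D
  alone. After completing the square, B D = t (t + |x|^2 + |y|^2): the lines treat x and y
  differently, but their superposition is rotation invariant on \<real>^8. A general centre costs
  nothing, because a translate of \<tau> has the same shape and again vanishing line integrals.

  The obstacle is convergence. \<tau> is only known to be square integrable, and (t + |z|^2)^-2 just
  fails to be square integrable on \<real>^8, so their product has to be controlled through Fubini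
  and a bound on the line integrals. That bound blows up as c tends to 0, the slope that the group
  never reaches, and must stay integrable there. As for the differences in t, each one gains a
  factor of order |z|^-2; the second has order |z|^-8, whose integral still diverges logarithmically
  in dimension 8, so the third is the first that works.\<close>

lemma nn_integral_lborel_affine:
  fixes f :: "'a::euclidean_space \<Rightarrow> ennreal"
  assumes [measurable]: "f \<in> borel_measurable borel" and c: "c \<noteq> 0"
  shows "(\<integral>\<^sup>+x. f x \<partial>lborel) = ennreal (\<bar>c\<bar> ^ DIM('a)) * (\<integral>\<^sup>+x. f (t + c *\<^sub>R x) \<partial>lborel)"
  by (subst lborel_affine[OF c, of t])
     (simp add: nn_integral_density nn_integral_distr nn_integral_cmult)

lemma nn_integral_lborel_shift:
  fixes f :: "'a::euclidean_space \<Rightarrow> ennreal"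
  assumes [measurable]: "f \<in> borel_measurable borel"
  shows "(\<integral>\<^sup>+x. f (t + x) \<partial>lborel) = (\<integral>\<^sup>+x. f x \<partial>lborel)"
  using nn_integral_lborel_affine[of f 1 t] by simp

lemma integrable_lborel_affine:
  fixes f :: "'a::euclidean_space \<Rightarrow> 'b::{banach, second_countable_topology}"
  assumes f: "integrable lborel f" and c: "c \<noteq> 0"
  shows "integrable lborel (\<lambda>x. f (t + c *\<^sub>R x))"
proof -
  have "f \<in> borel_measurable borel"
    using borel_measurable_integrable[OF f] by simp
  then show ?thesis
    using f unfolding integrable_iff_bounded
    by (subst (asm) nn_integral_lborel_affine[OF _ c, of _ t]) (auto simp: ennreal_mult_less_top c)
qed

lemma integrable_lborel_shift:
  fixes f :: "'a::euclidean_space \<Rightarrow> 'b::{banach, second_countable_topology}"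
  assumes "integrable lborel f"
  shows "integrable lborel (\<lambda>x. f (t + x))"
  using integrable_lborel_affine[OF assms, of 1 t] by simp

lemma integral_lborel_affine:
  fixes f :: "'a::euclidean_space \<Rightarrow> 'b::{banach, second_countable_topology}"
  assumes f[measurable]: "f \<in> borel_measurable borel" and c: "c \<noteq> 0"
  shows "(\<integral>x. f x \<partial>lborel) = (\<bar>c\<bar> ^ DIM('a)) *\<^sub>R (\<integral>x. f (t + c *\<^sub>R x) \<partial>lborel)"
proof -
  have "(\<integral>x. f x \<partial>lborel) = (\<integral>x. f x \<partial>density (distr lborel borel (\<lambda>x. t + c *\<^sub>R x)) (\<lambda>_. \<bar>c\<bar> ^ DIM('a)))"
    using lborel_affine[OF c, of t] by simp
  also have "\<dots> = (\<integral>x. (\<bar>c\<bar> ^ DIM('a)) *\<^sub>R f (t + c *\<^sub>R x) \<partial>lborel)"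
    by (subst integral_density) (auto simp: integral_distr)
  finally show ?thesis by simp
qed

lemma integral_lborel_shift:
  fixes f :: "'a::euclidean_space \<Rightarrow> 'b::{banach, second_countable_topology}"
  assumes [measurable]: "f \<in> borel_measurable borel"
  shows "(\<integral>x. f (t + x) \<partial>lborel) = (\<integral>x. f x \<partial>lborel)"
  using integral_lborel_affine[of f 1 t] by simp

text \<open>A superposition of balls serves as majorant for radial functions: growing radii control
  the decay at infinity, shrinking radii a singularity at 0.\<close>

lemma nn_integral_suminf_ball_finite:
  fixes r :: "nat \<Rightarrow> real" and a :: "nat \<Rightarrow> real"
  assumes "\<And>n. r n \<ge> 0" "\<And>n. a n \<ge> 0" "summable (\<lambda>n. a n * r n ^ DIM('a::euclidean_space))"
  shows "(\<integral>\<^sup>+x. (\<Sum>n. ennreal (a n) * indicator (ball 0 (r n)) x) \<partial>(lborel::'a measure)) < \<infinity>"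
proof -
  let ?V = "unit_ball_vol (real DIM('a))"
  have "(\<integral>\<^sup>+x. (\<Sum>n. ennreal (a n) * indicator (ball 0 (r n)) x) \<partial>(lborel::'a measure))
      = (\<Sum>n. \<integral>\<^sup>+x. ennreal (a n) * indicator (ball 0 (r n)) x \<partial>(lborel::'a measure))"
    by (rule nn_integral_suminf) (intro borel_measurable_times_ennreal borel_measurable_const borel_measurable_indicator, simp)
  also have "\<dots> = (\<Sum>n. ennreal (?V * (a n * r n ^ DIM('a))))"
  proof (rule suminf_cong)
    fix n
    show "(\<integral>\<^sup>+x. ennreal (a n) * indicator (ball 0 (r n)) x \<partial>(lborel::'a measure)) = ennreal (?V * (a n * r n ^ DIM('a)))"
      using assms by (simp add: nn_integral_cmult_indicator emeasure_ball ennreal_mult[symmetric] mult_ac)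
  qed
  also have "\<dots> = ennreal (\<Sum>n. ?V * (a n * r n ^ DIM('a)))"
    using assms by (intro suminf_ennreal2) (auto intro!: summable_mult)
  finally show ?thesis by simp
qed

text \<open>On the dyadic shell with outer radius 2^n the integrand is of order 4^(-m n), while the
  ball has volume of order 2^(n DIM). The resulting series is geometric and converges exactly when
  DIM < 2 m.\<close>

lemma nn_integral_inverse_power_finite:
  assumes m: "DIM('a::euclidean_space) < 2 * m"
  shows "(\<integral>\<^sup>+x. ennreal (1 / (1 + (norm x)\<^sup>2) ^ m) \<partial>(lborel::'a measure)) < \<infinity>"
proof -
  define r :: "nat \<Rightarrow> real" where "r = (\<lambda>n. 2 ^ n)"
  \<comment> \<open>The factor \<open>4 ^ m\<close> pays for the index shift: the least n with |x| <
    2^n only guarantees |x| \<ge> 2^(n-1). For n = 0 the bound \<open>a 0 = 4 ^ m\<close> exceeds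
    the trivial bound 1.\<close>
  define a :: "nat \<Rightarrow> real" where "a = (\<lambda>n. 4 ^ m * (1 / 4 ^ m) ^ n)"
  have "2 * (2::real) ^ DIM('a) = 2 ^ Suc DIM('a)" by simp
  also have "\<dots> \<le> 2 ^ (2 * m)" using m by (intro power_increasing) auto
  also have "\<dots> = 4 ^ m" by (simp add: power_mult)
  finally have le: "2 * (2::real) ^ DIM('a) \<le> 4 ^ m" .
  have "summable (\<lambda>n. 4 ^ m * (1 / 4 ^ m * 2 ^ DIM('a)) ^ n :: real)"
    using le by (intro summable_mult summable_geometric)
      (simp add: divide_simps less_le_trans[of _ "2 * 2 ^ DIM('a)"])
  then have s: "summable (\<lambda>n. a n * r n ^ DIM('a))"
    by (simp add: a_def r_def power_mult_distrib power_divide power_mult[symmetric] mult.commute)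
  have "ennreal (1 / (1 + (norm x)\<^sup>2) ^ m) \<le> (\<Sum>n. ennreal (a n) * indicator (ball 0 (r n)) x)" for x :: 'a
  proof -
    obtain k where k: "norm x < 2 ^ k"
      using real_arch_pow[of 2 "norm x"] by auto
    define n where "n = (LEAST n. norm x < 2 ^ n)"
    have n: "norm x < 2 ^ n"
      unfolding n_def by (rule LeastI[of "\<lambda>n. norm x < 2 ^ n", OF k])
    have "1 / (1 + (norm x)\<^sup>2) ^ m \<le> a n"
    proof (cases n)
      case 0
      have "1 / (1 + (norm x)\<^sup>2) ^ m \<le> 1 / 1"
        by (intro divide_left_mono) (auto simp: one_le_power add_pos_nonneg)
      also have "\<dots> \<le> 4 ^ m" by (simp add: one_le_power)
      finally show ?thesis unfolding a_def 0 by simp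
    next
      case (Suc j)
      have "\<not> norm x < 2 ^ j"
        using not_less_Least[of j "\<lambda>n. norm x < 2 ^ n"] Suc unfolding n_def by auto
      then have "(2 ^ j)\<^sup>2 \<le> (norm x)\<^sup>2" by (intro power_mono) auto
      then have "(4::real) ^ j \<le> 1 + (norm x)\<^sup>2" by (simp add: power2_eq_square flip: power_mult_distrib)
      then have "((4::real) ^ j) ^ m \<le> (1 + (norm x)\<^sup>2) ^ m" by (intro power_mono) auto
      then have "1 / (1 + (norm x)\<^sup>2) ^ m \<le> 1 / (4 ^ j) ^ m"
        by (intro divide_left_mono) (auto simp: add_pos_nonneg)
      also have "\<dots> = a n"
        by (simp add: a_def Suc power_divide power_mult[symmetric] mult.commute[of m] power_add)
      finally show ?thesis .
    qed
    then have "ennreal (1 / (1 + (norm x)\<^sup>2) ^ m) \<le> ennreal (a n) * indicator (ball 0 (r n)) x"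
      using n by (simp add: r_def ennreal_leI)
    also have "\<dots> = (\<Sum>i\<in>{n}. ennreal (a i) * indicator (ball 0 (r i)) x)"
        by (subst sum.insert) auto
    also have "\<dots> \<le> (\<Sum>n. ennreal (a n) * indicator (ball 0 (r n)) x)"
      by (intro sum_le_suminf) auto
    finally show ?thesis .
  qed
  then have "(\<integral>\<^sup>+x. ennreal (1 / (1 + (norm x)\<^sup>2) ^ m) \<partial>(lborel::'a measure))
      \<le> (\<integral>\<^sup>+x. (\<Sum>n. ennreal (a n) * indicator (ball 0 (r n)) x) \<partial>(lborel::'a measure))"
    by (intro nn_integral_mono) auto
  also have "\<dots> < \<infinity>"
    using s by (intro nn_integral_suminf_ball_finite) (auto simp: a_def r_def)
  finally show ?thesis .
qed

text \<open>This integrand is the slope dependence of the bound in \<open>cross_line_weight\<close>.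
  The singularity at 0 has order 2, below the dimension 4, and is handled by shrinking balls; at
  infinity the decay has order 6, above 4, and is compared with the exponent 3 of the previous
  lemma.\<close>

lemma nn_integral_inverse_norm_power2_quat_finite:
  "(\<integral>\<^sup>+c. ennreal (1 / ((norm c)\<^sup>2 * (1 + (norm c)\<^sup>2)\<^sup>2)) \<partial>(lborel::quat measure)) < \<infinity>"
proof -
  define r :: "nat \<Rightarrow> real" where "r = (\<lambda>n. (1 / 2) ^ n)"
  \<comment> \<open>On the shell between radii 2^-(n+1) and 2^-n the function |x|^-2 is at most
    4^(n+1).\<close>
  define a :: "nat \<Rightarrow> real" where "a = (\<lambda>n. 4 * 4 ^ n)"
  have "summable (\<lambda>n. 4 * (1 / 4) ^ n :: real)"
    by (intro summable_mult summable_geometric) simp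
  also have "(\<lambda>n. 4 * (1 / 4) ^ n :: real) = (\<lambda>n. a n * r n ^ 4)"
  proof
    fix n
    have "r n ^ 4 = (1 / 16) ^ n"
      by (simp add: r_def power_divide power_mult[symmetric] mult.commute[of n] power_mult)
    then have "a n * r n ^ 4 = 4 * (4 * (1 / 16)) ^ n"
      unfolding a_def power_mult_distrib by simp
    then show "4 * (1 / 4) ^ n = a n * r n ^ 4" by simp
  qed
  finally have s: "summable (\<lambda>n. a n * r n ^ DIM(quat))" by simp
  have "ennreal (1 / ((norm x)\<^sup>2 * (1 + (norm x)\<^sup>2)\<^sup>2)) \<le>
      (\<Sum>n. ennreal (a n) * indicator (ball 0 (r n)) x) + ennreal 2 * ennreal (1 / (1 + (norm x)\<^sup>2) ^ 3)" for x :: quat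
  proof -
    consider "x = 0" | "0 < norm x" "norm x < 1" | "norm x \<ge> 1" by fastforce
    then show ?thesis
    proof cases
      \<comment> \<open>At the origin the integrand is 1 / 0 = 0.\<close>
      case 1 then show ?thesis by simp
    next
      case 2
      obtain k where k: "(1 / 2) ^ k < norm x"
        using real_arch_pow_inv[of "norm x" "1/2"] 2 by auto
      define n where "n = (LEAST n. (1 / 2) ^ n \<le> norm x)"
      have n: "(1 / 2) ^ n \<le> norm x"
        unfolding n_def by (rule LeastI[of "\<lambda>n. (1 / 2) ^ n \<le> norm x" k]) (use k in simp)
      with 2 obtain j where j: "n = Suc j" by (cases n) auto
      have "\<not> (1 / 2) ^ j \<le> norm x"
        using not_less_Least[of j "\<lambda>n. (1 / 2) ^ n \<le> norm x"] j unfolding n_def by auto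
      then have in_ball: "x \<in> ball 0 (r j)" by (simp add: r_def)
      have "((1 / 2) ^ n)\<^sup>2 \<le> (norm x)\<^sup>2" using n by (intro power_mono) auto
      moreover have "((1 / 2) ^ n)\<^sup>2 = 1 / a j"
        by (simp add: a_def j power_divide power2_eq_square flip: power_mult_distrib)
      ultimately have le: "1 / a j \<le> (norm x)\<^sup>2" by simp
      have aj: "a j > 0" by (simp add: a_def)
      have x2: "0 < (norm x)\<^sup>2" using 2 by simp
      have "(1::real) \<le> (1 + (norm x)\<^sup>2)\<^sup>2" by (simp add: one_le_power)
      then have "(norm x)\<^sup>2 * 1 \<le> (norm x)\<^sup>2 * (1 + (norm x)\<^sup>2)\<^sup>2"
        by (intro mult_left_mono) auto
      then have "1 / ((norm x)\<^sup>2 * (1 + (norm x)\<^sup>2)\<^sup>2) \<le> 1 / (norm x)\<^sup>2"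
        using x2 by (intro divide_left_mono mult_pos_pos zero_less_power) (auto simp: add_pos_nonneg)
      also have "\<dots> \<le> a j"
        using le aj x2 by (simp add: field_simps)
      finally have "ennreal (1 / ((norm x)\<^sup>2 * (1 + (norm x)\<^sup>2)\<^sup>2)) \<le> ennreal (a j) * indicator (ball 0 (r j)) x"
        using in_ball by (simp add: ennreal_leI)
      also have "\<dots> = (\<Sum>i\<in>{j}. ennreal (a i) * indicator (ball 0 (r i)) x)"
        by (subst sum.insert) auto
      also have "\<dots> \<le> (\<Sum>n. ennreal (a n) * indicator (ball 0 (r n)) x)"
        by (intro sum_le_suminf) auto
      finally show ?thesis by (rule order_trans) simp
    next
      case 3
      then have x: "1 \<le> (norm x)\<^sup>2" by (simp add: one_le_power)
      let ?q = "1 + (norm x)\<^sup>2"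
      have "?q ^ 3 = ?q * ?q\<^sup>2" by (simp add: power3_eq_cube power2_eq_square)
      also have "\<dots> \<le> 2 * ((norm x)\<^sup>2 * ?q\<^sup>2)" using x by (simp add: mult.assoc[symmetric] mult_right_mono)
      finally have "1 / ((norm x)\<^sup>2 * ?q\<^sup>2) \<le> 2 * (1 / ?q ^ 3)"
        using x by (simp add: divide_simps zero_less_power add_pos_nonneg mult_less_0_iff not_less)
      then have "ennreal (1 / ((norm x)\<^sup>2 * ?q\<^sup>2)) \<le> ennreal 2 * ennreal (1 / ?q ^ 3)"
        by (subst ennreal_mult[symmetric]) (auto simp: ennreal_leI)
      then show ?thesis by (rule order_trans) simp
    qed
  qed
  then have "(\<integral>\<^sup>+c. ennreal (1 / ((norm c)\<^sup>2 * (1 + (norm c)\<^sup>2)\<^sup>2)) \<partial>(lborel::quat measure)) \<le>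
      (\<integral>\<^sup>+x. (\<Sum>n. ennreal (a n) * indicator (ball 0 (r n)) x) + ennreal 2 * ennreal (1 / (1 + (norm x)\<^sup>2) ^ 3) \<partial>(lborel::quat measure))"
    by (intro nn_integral_mono) auto
  also have "\<dots> = (\<integral>\<^sup>+x. (\<Sum>n. ennreal (a n) * indicator (ball 0 (r n)) x) \<partial>(lborel::quat measure)) +
      ennreal 2 * (\<integral>\<^sup>+x. ennreal (1 / (1 + (norm x)\<^sup>2) ^ 3) \<partial>(lborel::quat measure))"
    by (subst nn_integral_add)
      (auto simp: nn_integral_cmult intro!: borel_measurable_suminf_order borel_measurable_times_ennreal borel_measurable_indicator)
  also have "\<dots> < \<infinity>"
  proof -
    have "(\<integral>\<^sup>+x. (\<Sum>n. ennreal (a n) * indicator (ball 0 (r n)) x) \<partial>(lborel::quat measure)) < \<infinity>"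
      using s by (intro nn_integral_suminf_ball_finite) (auto simp: a_def r_def)
    moreover have "(\<integral>\<^sup>+x. ennreal (1 / (1 + (norm x)\<^sup>2) ^ 3) \<partial>(lborel::quat measure)) < \<infinity>"
      by (rule nn_integral_inverse_power_finite) simp
    ultimately show ?thesis by (simp add: ennreal_mult_less_top)
  qed
  finally show ?thesis .
qed

section \<open>The kernel on the slopes of quaternionic lines\<close>

text \<open>The value is \<pi>^2 / 6; the proof treats it as an unspecified positive
  constant.\<close>

definition quat_mass :: real where
  "quat_mass = (\<integral>c. 1 / (1 + (norm (c::quat))\<^sup>2) ^ 4 \<partial>lborel)"

lemma nn_integral_pos_lborel:
  fixes f :: "'a::euclidean_space \<Rightarrow> real"
  assumes "\<And>x. f x > 0" and [measurable]: "f \<in> borel_measurable borel"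
  shows "(\<integral>\<^sup>+x. ennreal (f x) \<partial>lborel) > 0"
proof -
  have "\<not> (AE x in lborel. ennreal (f x) = 0)"
  proof
    assume "AE x in lborel. ennreal (f x) = 0"
    then have "AE x::'a in lborel. False"
      by eventually_elim (use assms(1) in \<open>auto simp: ennreal_eq_0_iff not_le[symmetric]\<close>)
    then show False using AE_E[of "\<lambda>x::'a. False" lborel]
      by (auto simp: AE_iff_measurable[OF _ refl])
  qed
  then have "(\<integral>\<^sup>+x. ennreal (f x) \<partial>lborel) \<noteq> 0"
    by (subst nn_integral_0_iff_AE) auto
  then show ?thesis by (simp add: zero_less_iff_neq_zero)
qed

lemma nn_integral_quat_mass:
  "(\<integral>\<^sup>+c. ennreal (1 / (1 + (norm c)\<^sup>2) ^ 4) \<partial>(lborel::quat measure)) = ennreal quat_mass"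
  unfolding quat_mass_def
  by (rule nn_integral_eq_integral)
    (auto intro!: integrableI_nonneg nn_integral_inverse_power_finite add_nonneg_nonneg)

lemma quat_mass_pos: "quat_mass > 0"
proof -
  have "(\<integral>\<^sup>+c. ennreal (1 / (1 + (norm c)\<^sup>2) ^ 4) \<partial>(lborel::quat measure)) > 0"
    by (rule nn_integral_pos_lborel) (auto intro!: divide_pos_pos zero_less_power add_pos_nonneg simp: add_nonneg_eq_0_iff)
  then show ?thesis by (simp add: nn_integral_quat_mass)
qed

text \<open>The substitution \<open>c = - s + r *\<^sub>R u\<close> with
  \<open>r\<^sup>2 = D / B\<close> turns the quadratic into D (1 + |u|^2), with Jacobian r^4 = (D /
  B)^2.\<close>

lemma nn_integral_inverse_quadratic_power4:
  fixes B D :: real and s :: quat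
  assumes B: "B > 0" and D: "D > 0"
  shows "(\<integral>\<^sup>+c. ennreal (1 / (B * (norm (c + s))\<^sup>2 + D) ^ 4) \<partial>(lborel::quat measure)) = ennreal (quat_mass / (B * D)\<^sup>2)"
proof -
  define r where "r = sqrt (D / B)"
  have r: "r > 0" "r\<^sup>2 = D / B" using B D by (simp_all add: r_def)
  have "r ^ 4 = (D / B)\<^sup>2" using power_mult[of r 2 2] r(2) by simp
  have eq: "ennreal (1 / (B * (norm (- s + r *\<^sub>R c + s))\<^sup>2 + D) ^ 4) = ennreal (1 / D ^ 4) * ennreal (1 / (1 + (norm c)\<^sup>2) ^ 4)" for c :: quat
  proof -
    have "B * (norm (- s + r *\<^sub>R c + s))\<^sup>2 + D = D * (1 + (norm c)\<^sup>2)"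
      using r B by (simp add: power_mult_distrib field_simps)
    then show ?thesis
      using D by (subst ennreal_mult[symmetric]) (auto simp: power_mult_distrib)
  qed
  have "(\<integral>\<^sup>+c. ennreal (1 / (B * (norm (c + s))\<^sup>2 + D) ^ 4) \<partial>(lborel::quat measure)) =
    ennreal (\<bar>r\<bar> ^ DIM(quat)) * (\<integral>\<^sup>+c. ennreal (1 / (B * (norm (- s + r *\<^sub>R c + s))\<^sup>2 + D) ^ 4) \<partial>(lborel::quat measure))"
    using r by (intro nn_integral_lborel_affine) auto
  also have "\<dots> = ennreal ((D / B)\<^sup>2) * (ennreal (1 / D ^ 4) * ennreal quat_mass)"
    unfolding eq nn_integral_quat_mass[symmetric]
    using \<open>r ^ 4 = (D / B)\<^sup>2\<close> r(1) by (simp add: nn_integral_cmult)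
  also have "\<dots> = ennreal (quat_mass / (B * D)\<^sup>2)"
    using B D quat_mass_pos
    by (simp flip: ennreal_mult add: field_simps power2_eq_square power4_eq_xxxx)
  finally show ?thesis .
qed

text \<open>Completing the square in \<open>c\<close>.\<close>

lemma line_distance_square:
  fixes c x y :: quat and t :: real
  assumes t: "t > 0"
  shows "t * (1 + (norm c)\<^sup>2) + (norm (x + c * y))\<^sup>2 =
    (t + (norm y)\<^sup>2) * (norm (c + (1 / (t + (norm y)\<^sup>2)) *\<^sub>R (x * quat_cnj y)))\<^sup>2 +
      t * (t + (norm x)\<^sup>2 + (norm y)\<^sup>2) / (t + (norm y)\<^sup>2)"
proof -
  define B where "B = t + (norm y)\<^sup>2"
  have B: "B > 0" using t by (simp add: B_def add_pos_nonneg)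
  \<comment> \<open>Right multiplication by \<open>quat_cnj y\<close> is the adjoint of right
    multiplication by \<open>y\<close>, so the mixed term becomes linear in \<open>c\<close> with
    explicit coefficient.\<close>
  have in1: "inner x (c * y) = inner c (x * quat_cnj y)"
    by (simp add: inner_quat_def algebra_simps)
  have n1: "(norm (x + c * y))\<^sup>2 = (norm x)\<^sup>2 + 2 * inner c (x * quat_cnj y) + (norm c)\<^sup>2 * (norm y)\<^sup>2"
    unfolding in1[symmetric] power_mult_distrib[symmetric] norm_mult[symmetric]
    by (simp add: power2_norm_eq_inner inner_add inner_commute)
  have n2: "(norm (c + (1 / B) *\<^sub>R (x * quat_cnj y)))\<^sup>2 =
      (norm c)\<^sup>2 + 2 / B * inner c (x * quat_cnj y) + (norm x)\<^sup>2 * (norm y)\<^sup>2 / B\<^sup>2"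
  proof -
    have "(norm (x * quat_cnj y))\<^sup>2 = (norm x)\<^sup>2 * (norm y)\<^sup>2"
      by (simp add: norm_mult power_mult_distrib)
    then show ?thesis
      unfolding power2_norm_eq_inner by (simp add: inner_add inner_commute power2_eq_square)
  qed
  have "B * (norm (c + (1 / B) *\<^sub>R (x * quat_cnj y)))\<^sup>2 + t * (B + (norm x)\<^sup>2) / B =
      B * (norm c)\<^sup>2 + 2 * inner c (x * quat_cnj y) + ((norm x)\<^sup>2 * (norm y)\<^sup>2 + t * (B + (norm x)\<^sup>2)) / B"
    unfolding n2 using B by (simp add: field_simps power2_eq_square)
  also have "(norm x)\<^sup>2 * (norm y)\<^sup>2 + t * (B + (norm x)\<^sup>2) = B * (t + (norm x)\<^sup>2)"
    by (simp add: B_def algebra_simps)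
  also have "\<dots> / B = t + (norm x)\<^sup>2" using B by simp
  finally show ?thesis
    unfolding n1 by (simp add: B_def algebra_simps)
qed

definition line_weight :: "real \<Rightarrow> quat \<Rightarrow> quat \<Rightarrow> real" where
  "line_weight t c p = 1 / (t * (1 + (norm c)\<^sup>2) + (norm p)\<^sup>2) ^ 4"

lemma line_weight_nonneg [simp]: "t > 0 \<Longrightarrow> 0 \<le> line_weight t c p"
  by (simp add: line_weight_def)

lemma line_weight_measurable [measurable]:
  "(\<lambda>(c, p). line_weight t c p) \<in> borel_measurable (borel \<Otimes>\<^sub>M borel)"
  unfolding line_weight_def by measurable

text \<open>Here the point (x, y) is fixed and c runs through the lines that contain it. The factor
  t + |y|^2 is both the leading coefficient and the denominator of the constant term in
  \<open>line_distance_square\<close>, so it cancels from their product.\<close>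

lemma nn_integral_line_weight_slope:
  assumes t: "t > 0"
  shows "(\<integral>\<^sup>+c. ennreal (line_weight t c (x + c * y)) \<partial>lborel) =
    ennreal (quat_mass / (t * (t + (norm x)\<^sup>2 + (norm y)\<^sup>2))\<^sup>2)"
proof -
  have "t + (norm y)\<^sup>2 > 0" "t + (norm x)\<^sup>2 + (norm y)\<^sup>2 > 0" using t by (simp_all add: add_pos_nonneg)
  then show ?thesis
    using t unfolding line_weight_def line_distance_square[OF t]
    by (subst nn_integral_inverse_quadratic_power4) auto
qed

lemma nn_integral_line_weight_offset:
  assumes t: "t > 0"
  shows "(\<integral>\<^sup>+p. ennreal (line_weight t c p) \<partial>lborel) = ennreal (quat_mass / (t * (1 + (norm c)\<^sup>2))\<^sup>2)"
  using nn_integral_inverse_quadratic_power4[of 1 "t * (1 + (norm c)\<^sup>2)" 0] t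
  by (simp add: line_weight_def add.commute add_pos_nonneg)

section \<open>Integrals over the quaternionic lines of a fixed slope\<close>

lemma distr_lborel_shear:
  fixes L :: "'b::euclidean_space \<Rightarrow> 'a::euclidean_space"
  assumes [measurable]: "L \<in> borel_measurable borel"
  shows "distr lborel borel (\<lambda>z. (fst z + L (snd z), snd z)) = (lborel :: ('a \<times> 'b) measure)"
proof (rule measure_eqI)
  fix A :: "('a \<times> 'b) set" assume "A \<in> sets (distr lborel borel (\<lambda>z. (fst z + L (snd z), snd z)))"
  then have A: "A \<in> sets borel" by simp
  then have [measurable]: "A \<in> sets (borel \<Otimes>\<^sub>M borel)" unfolding borel_prod .
  have [measurable]: "(\<lambda>z::'a \<times> 'b. (fst z + L (snd z), snd z)) \<in> borel_measurable borel"
    unfolding borel_prod[symmetric] by measurable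
  have "emeasure (distr lborel borel (\<lambda>z. (fst z + L (snd z), snd z))) A = (\<integral>\<^sup>+z. indicator A z \<partial>distr lborel borel (\<lambda>z. (fst z + L (snd z), snd z)))"
    using A by simp
  also have "\<dots> = (\<integral>\<^sup>+z. indicator A (fst z + L (snd z), snd z) \<partial>(lborel \<Otimes>\<^sub>M lborel))"
    using A by (subst nn_integral_distr) (auto simp: lborel_prod)
  also have "\<dots> = (\<integral>\<^sup>+y. \<integral>\<^sup>+x. indicator A (L y + x, y) \<partial>lborel \<partial>lborel)"
    by (subst lborel_pair.nn_integral_snd[symmetric]) (auto simp: add.commute)
  also have "\<dots> = (\<integral>\<^sup>+y. \<integral>\<^sup>+x. indicator A (x, y) \<partial>lborel \<partial>lborel)"
    by (intro nn_integral_cong nn_integral_lborel_shift) measurable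
  also have "\<dots> = (\<integral>\<^sup>+z. indicator A z \<partial>(lborel \<Otimes>\<^sub>M lborel))"
    by (subst lborel_pair.nn_integral_snd[symmetric]) auto
  also have "\<dots> = emeasure lborel A"
    using A by (simp add: lborel_prod)
  finally show "emeasure (distr lborel borel (\<lambda>z. (fst z + L (snd z), snd z))) A = emeasure lborel A" .
qed simp

lemma nn_integral_norm_square:
  assumes "sq_integrable f"
  shows "(\<integral>\<^sup>+x. ennreal ((norm (f x))\<^sup>2) \<partial>lborel) = ennreal (\<integral>x. (norm (f x))\<^sup>2 \<partial>lborel)"
  using assms by (intro nn_integral_eq_integral) (auto simp: sq_integrable_def)

text \<open>The substitution \<open>p - c * y\<close> makes the integral of |f|^2 along the line
  cost |c|^-4, which is not integrable near 0 in \<real>^4. The inequality between the product and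
  the squares is therefore applied to |c| |f| and |g| / |c|: both terms then cost |c|^-2.\<close>

lemma nn_integral_along_line:
  fixes c p :: quat
  assumes "sq_integrable f" "sq_integrable g" and c: "c \<noteq> 0"
  shows "(\<integral>\<^sup>+y. ennreal (norm (f (p - c * y)) * norm (g y)) \<partial>lborel) \<le>
    ennreal (((\<integral>x. (norm (f x))\<^sup>2 \<partial>lborel) + (\<integral>x. (norm (g x))\<^sup>2 \<partial>lborel)) / (2 * (norm c)\<^sup>2))"
proof -
  let ?Nf = "\<integral>x. (norm (f x))\<^sup>2 \<partial>lborel" and ?Ng = "\<integral>x. (norm (g x))\<^sup>2 \<partial>lborel"
  have [measurable]: "f \<in> borel_measurable borel" "g \<in> borel_measurable borel"
    using assms by (auto intro: sq_integrable_measurable)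
  have n: "norm c > 0" using c by simp
  have N: "?Nf \<ge> 0" "?Ng \<ge> 0" by simp_all
  \<comment> \<open>The line is parametrized by an affine map of the form used in the group action,
    so that its Jacobian is known.\<close>
  define a b where "a = - inverse c" and "b = inverse c * p"
  have a: "a \<noteq> 0" using c by (simp add: a_def)
  have ab: "inverse a * (y - b) = p - c * y" for y
    using c by (simp add: a_def b_def right_diff_distrib mult.assoc[symmetric])
  have "(\<integral>\<^sup>+y. ennreal ((norm (f (p - c * y)))\<^sup>2) \<partial>lborel) =
      (\<integral>\<^sup>+y. ennreal ((norm (f y))\<^sup>2) \<partial>distr lborel borel (\<lambda>x. inverse a * (x - b)))"
    by (subst nn_integral_distr) (auto simp: ab)
  also have "\<dots> = ennreal (norm a ^ 4) * ennreal ?Nf"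
    unfolding distr_lborel_quat_affine[OF a]
    by (simp add: nn_integral_density nn_integral_cmult nn_integral_norm_square assms)
  also have "\<dots> = ennreal (?Nf / norm c ^ 4)"
    using c by (simp add: a_def norm_inverse power_inverse divide_inverse mult.commute flip: ennreal_mult)
  finally have F: "(\<integral>\<^sup>+y. ennreal ((norm (f (p - c * y)))\<^sup>2) \<partial>lborel) = ennreal (?Nf / norm c ^ 4)" .
  have "(\<integral>\<^sup>+y. ennreal (norm (f (p - c * y)) * norm (g y)) \<partial>lborel) \<le>
    (\<integral>\<^sup>+y. ennreal ((norm c)\<^sup>2 / 2) * ennreal ((norm (f (p - c * y)))\<^sup>2) +
      ennreal (1 / (2 * (norm c)\<^sup>2)) * ennreal ((norm (g y))\<^sup>2) \<partial>lborel)"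
  proof (rule nn_integral_mono)
    fix y :: quat
    let ?u = "norm (f (p - c * y))" and ?v = "norm (g y)"
    have "0 \<le> (norm c * ?u - ?v / norm c)\<^sup>2" by simp
    also have "\<dots> = (norm c)\<^sup>2 * ?u\<^sup>2 - 2 * ?u * ?v + ?v\<^sup>2 / (norm c)\<^sup>2"
      using n by (simp add: power2_diff power_mult_distrib power_divide)
    finally have "?u * ?v \<le> (norm c)\<^sup>2 / 2 * ?u\<^sup>2 + 1 / (2 * (norm c)\<^sup>2) * ?v\<^sup>2"
      by simp
    then show "ennreal (?u * ?v) \<le> ennreal ((norm c)\<^sup>2 / 2) * ennreal (?u\<^sup>2) + ennreal (1 / (2 * (norm c)\<^sup>2)) * ennreal (?v\<^sup>2)"
      by (simp flip: ennreal_mult ennreal_plus add: ennreal_leI)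
  qed
  also have "\<dots> = ennreal ((norm c)\<^sup>2 / 2) * ennreal (?Nf / norm c ^ 4) + ennreal (1 / (2 * (norm c)\<^sup>2)) * ennreal ?Ng"
    by (simp add: nn_integral_add nn_integral_cmult F nn_integral_norm_square assms)
  also have "\<dots> = ennreal ((norm c)\<^sup>2 / 2 * (?Nf / norm c ^ 4) + 1 / (2 * (norm c)\<^sup>2) * ?Ng)"
    using N by (simp flip: ennreal_mult ennreal_plus)
  also have "(norm c)\<^sup>2 / 2 * (?Nf / norm c ^ 4) + 1 / (2 * (norm c)\<^sup>2) * ?Ng = (?Nf + ?Ng) / (2 * (norm c)\<^sup>2)"
    using n by (simp add: field_simps power4_eq_xxxx power2_eq_square)
  finally show ?thesis .
qed

text \<open>This is the \<tau> of the overview.\<close>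

definition cross :: "(quat \<Rightarrow> quat) \<Rightarrow> (quat \<Rightarrow> quat) \<Rightarrow> quat \<times> quat \<Rightarrow> quat" where
  "cross f g z = quat_cnj (f (fst z)) * g (snd z)"

lemma norm_cross: "norm (cross f g z) = norm (f (fst z)) * norm (g (snd z))"
  by (simp add: cross_def norm_mult)

lemma cross_measurable [measurable]:
  assumes [measurable]: "f \<in> borel_measurable borel" "g \<in> borel_measurable borel"
  shows "cross f g \<in> borel_measurable borel"
  unfolding cross_def[abs_def] borel_prod[symmetric] by measurable

lemma nn_integral_lborel_prod_fst:
  fixes F :: "'a::euclidean_space \<times> 'b::euclidean_space \<Rightarrow> ennreal"
  assumes "F \<in> borel_measurable borel"
  shows "(\<integral>\<^sup>+z. F z \<partial>lborel) = (\<integral>\<^sup>+x. \<integral>\<^sup>+y. F (x, y) \<partial>lborel \<partial>lborel)"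
proof -
  have [measurable]: "F \<in> borel_measurable (lborel \<Otimes>\<^sub>M lborel)" using assms by (simp add: lborel_prod)
  show ?thesis
    unfolding lborel_prod[symmetric] by (rule lborel.nn_integral_fst[symmetric]) measurable
qed

text \<open>In the coordinates p = x + c y and y the weight depends on p alone, and the inner
  integral over y is a line integral. With absolute values it is bounded by
  \<open>nn_integral_along_line\<close>, and the mass of the weight in p supplies (1 + |c|^2)^-2;
  this licenses Fubini for the signed integral, where the inner integral is 0.\<close>

lemma cross_line_weight:
  fixes f g :: "quat \<Rightarrow> quat"
  assumes fg: "sq_integrable f" "sq_integrable g" and c: "c \<noteq> 0" and t: "t > 0"
    and lines: "\<And>p. (\<integral>y. quat_cnj (f (p - c * y)) * g y \<partial>lborel) = 0"
  shows "(\<integral>\<^sup>+z. ennreal (line_weight t c (fst z + c * snd z) * norm (cross f g z)) \<partial>lborel) \<le>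
      ennreal (((\<integral>x. (norm (f x))\<^sup>2 \<partial>lborel) + (\<integral>x. (norm (g x))\<^sup>2 \<partial>lborel)) * quat_mass / (2 * t\<^sup>2)
        * (1 / ((norm c)\<^sup>2 * (1 + (norm c)\<^sup>2)\<^sup>2)))" (is ?bound)
    and "(\<integral>z. line_weight t c (fst z + c * snd z) *\<^sub>R cross f g z \<partial>lborel) = 0"
proof -
  have [measurable]: "f \<in> borel_measurable borel" "g \<in> borel_measurable borel"
    using assms by (auto intro: sq_integrable_measurable)
  let ?N = "(\<integral>x. (norm (f x))\<^sup>2 \<partial>lborel) + (\<integral>x. (norm (g x))\<^sup>2 \<partial>lborel)"
  \<comment> \<open>\<open>S\<close> sends (p, y) to (p - c y, y). For fixed y it is a translation,
    so it preserves Lebesgue measure.\<close>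
  define S where "S = (\<lambda>z::quat \<times> quat. (fst z + - (c * snd z), snd z))"
  define F where "F = (\<lambda>z. line_weight t c (fst z + c * snd z) *\<^sub>R cross f g z)"
  define H where "H = (\<lambda>z. line_weight t c (fst z) *\<^sub>R (quat_cnj (f (fst z - c * snd z)) * g (snd z)))"
  have [measurable]: "S \<in> borel \<rightarrow>\<^sub>M borel" "F \<in> borel_measurable borel" "H \<in> borel_measurable borel"
    unfolding S_def F_def H_def cross_def borel_prod[symmetric] by measurable
  have FS: "F (S z) = H z" for z
    by (simp add: F_def S_def H_def cross_def)
  have S: "distr lborel borel S = lborel"
    unfolding S_def by (rule distr_lborel_shear[of "\<lambda>y. - (c * y)"]) measurable
  have nn: "(\<integral>\<^sup>+z. ennreal (norm (F z)) \<partial>lborel) = (\<integral>\<^sup>+z. ennreal (norm (H z)) \<partial>lborel)"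
    by (subst S[symmetric], subst nn_integral_distr) (auto simp: FS)
  also have "\<dots> = (\<integral>\<^sup>+p. \<integral>\<^sup>+y. ennreal (norm (H (p, y))) \<partial>lborel \<partial>lborel)"
    by (rule nn_integral_lborel_prod_fst) measurable
  also have "\<dots> \<le> (\<integral>\<^sup>+p. ennreal (line_weight t c p) * ennreal (?N / (2 * (norm c)\<^sup>2)) \<partial>lborel)"
  proof (rule nn_integral_mono)
    fix p
    have "(\<integral>\<^sup>+y. ennreal (norm (H (p, y))) \<partial>lborel) =
      (\<integral>\<^sup>+y. ennreal (line_weight t c p) * ennreal (norm (f (p - c * y)) * norm (g y)) \<partial>lborel)"
      using t by (intro nn_integral_cong) (simp add: H_def norm_mult flip: ennreal_mult)
    also have "\<dots> = ennreal (line_weight t c p) * (\<integral>\<^sup>+y. ennreal (norm (f (p - c * y)) * norm (g y)) \<partial>lborel)"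
      by (rule nn_integral_cmult) measurable
    finally show "(\<integral>\<^sup>+y. ennreal (norm (H (p, y))) \<partial>lborel) \<le> ennreal (line_weight t c p) * ennreal (?N / (2 * (norm c)\<^sup>2))"
      using nn_integral_along_line[OF fg c, of p] by (simp add: mult_left_mono)
  qed
  also have "\<dots> = ennreal (quat_mass / (t * (1 + (norm c)\<^sup>2))\<^sup>2) * ennreal (?N / (2 * (norm c)\<^sup>2))"
    using t by (simp add: nn_integral_multc nn_integral_line_weight_offset)
  also have "\<dots> = ennreal (quat_mass / (t * (1 + (norm c)\<^sup>2))\<^sup>2 * (?N / (2 * (norm c)\<^sup>2)))"
    using quat_mass_pos by (simp flip: ennreal_mult)
  also have "quat_mass / (t * (1 + (norm c)\<^sup>2))\<^sup>2 * (?N / (2 * (norm c)\<^sup>2)) =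
      ?N * quat_mass / (2 * t\<^sup>2) * (1 / ((norm c)\<^sup>2 * (1 + (norm c)\<^sup>2)\<^sup>2))"
    by (simp add: power_mult_distrib mult_ac)
  finally have bound: "(\<integral>\<^sup>+z. ennreal (norm (F z)) \<partial>lborel) \<le> ennreal (?N * quat_mass / (2 * t\<^sup>2) * (1 / ((norm c)\<^sup>2 * (1 + (norm c)\<^sup>2)\<^sup>2)))" .
  then show ?bound
    using t by (simp add: F_def)
  have "integrable lborel H"
    using bound unfolding nn by (intro integrableI_bounded) (auto intro: le_less_trans)
  then have H: "integrable (lborel \<Otimes>\<^sub>M lborel) H" by (simp add: lborel_prod)
  have "(\<integral>z. F z \<partial>lborel) = (\<integral>z. H z \<partial>lborel)"
    by (subst S[symmetric], subst integral_distr) (auto simp: FS)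
  also have "\<dots> = (\<integral>p. \<integral>y. H (p, y) \<partial>lborel \<partial>lborel)"
    unfolding lborel_prod[symmetric] by (rule lborel_pair.integral_fst'[symmetric, OF H])
  also have "\<dots> = 0"
    by (simp add: H_def lines)
  finally show "(\<integral>z. line_weight t c (fst z + c * snd z) *\<^sub>R cross f g z \<partial>lborel) = 0"
    by (simp add: F_def)
qed

text \<open>The weighted \<open>cross\<close> is integrated over slopes and points in both orders:
  slopes first gives the radial kernel, points first gives 0. Integrability of kernel times
  \<open>cross\<close> is itself an output of Fubini, since Cauchy-Schwarz would diverge
  logarithmically.\<close>

lemma cross_inverse_square:
  fixes f g :: "quat \<Rightarrow> quat"
  assumes fg: "sq_integrable f" "sq_integrable g" and t: "t > 0"
    and lines: "\<And>c p. c \<noteq> 0 \<Longrightarrow> (\<integral>y. quat_cnj (f (p - c * y)) * g y \<partial>lborel) = 0"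
  shows "integrable lborel (\<lambda>z. (1 / (t + (norm z)\<^sup>2)\<^sup>2) *\<^sub>R cross f g z)" (is ?int)
    and "(\<integral>z. (1 / (t + (norm z)\<^sup>2)\<^sup>2) *\<^sub>R cross f g z \<partial>lborel) = 0" (is ?zero)
proof -
  have [measurable]: "f \<in> borel_measurable borel" "g \<in> borel_measurable borel"
    using assms by (auto intro: sq_integrable_measurable)
  define K where "K = ((\<integral>x. (norm (f x))\<^sup>2 \<partial>lborel) + (\<integral>x. (norm (g x))\<^sup>2 \<partial>lborel)) * quat_mass / (2 * t\<^sup>2)"
  have K: "K \<ge> 0" using quat_mass_pos by (simp add: K_def)
  define F where "F = (\<lambda>c z. line_weight t c (fst z + c * snd z) *\<^sub>R cross f g z)"
  have F_meas: "(\<lambda>(c, z). F c z) \<in> borel_measurable (lborel \<Otimes>\<^sub>M lborel)"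
    unfolding F_def cross_def lborel_prod[symmetric] by measurable
  have "(\<integral>\<^sup>+cz. ennreal (norm (case cz of (c, z) \<Rightarrow> F c z)) \<partial>(lborel \<Otimes>\<^sub>M lborel)) =
      (\<integral>\<^sup>+c. \<integral>\<^sup>+z. ennreal (norm (F c z)) \<partial>lborel \<partial>lborel)"
    using F_meas by (subst lborel.nn_integral_fst[symmetric]) auto
  also have "\<dots> \<le> (\<integral>\<^sup>+c. ennreal K * ennreal (1 / ((norm c)\<^sup>2 * (1 + (norm c)\<^sup>2)\<^sup>2)) \<partial>(lborel::quat measure))"
  \<comment> \<open>Slopes coming from the group are \<open>- inverse a\<close> and never 0; the
    missing slope is a null set.\<close>
  proof (rule nn_integral_mono_AE)
    have "(\<integral>\<^sup>+z. ennreal (norm (F c z)) \<partial>lborel) \<le> ennreal K * ennreal (1 / ((norm c)\<^sup>2 * (1 + (norm c)\<^sup>2)\<^sup>2))"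
      if "c \<noteq> 0" for c
      using cross_line_weight(1)[OF fg that t lines[OF that]] t K
      by (simp add: F_def K_def flip: ennreal_mult)
    then show "AE c in lborel. (\<integral>\<^sup>+z. ennreal (norm (F c z)) \<partial>lborel) \<le> ennreal K * ennreal (1 / ((norm c)\<^sup>2 * (1 + (norm c)\<^sup>2)\<^sup>2))"
      using AE_lborel_singleton[of "0::quat"] by (auto elim!: eventually_mono)
  qed
  also have "\<dots> = ennreal K * (\<integral>\<^sup>+c. ennreal (1 / ((norm c)\<^sup>2 * (1 + (norm c)\<^sup>2)\<^sup>2)) \<partial>(lborel::quat measure))"
    by (rule nn_integral_cmult) measurable
  also have "\<dots> < \<infinity>"
    using nn_integral_inverse_norm_power2_quat_finite by (simp add: ennreal_mult_less_top)
  finally have F_int: "integrable (lborel \<Otimes>\<^sub>M lborel) (\<lambda>(c, z). F c z)"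
    using F_meas by (intro integrableI_bounded)
  have inner: "(\<integral>c. F c z \<partial>lborel) = (quat_mass / t\<^sup>2) *\<^sub>R (1 / (t + (norm z)\<^sup>2)\<^sup>2) *\<^sub>R cross f g z" for z
  proof -
    obtain x y where z: "z = (x, y)" by (cases z)
    have w: "integrable lborel (\<lambda>c. line_weight t c (x + c * y)) \<and>
        (\<integral>c. line_weight t c (x + c * y) \<partial>lborel) = quat_mass / (t * (t + (norm x)\<^sup>2 + (norm y)\<^sup>2))\<^sup>2"
      using t quat_mass_pos
      by (subst nn_integral_eq_integrable[symmetric]) (auto simp: nn_integral_line_weight_slope)
    have nz: "(norm z)\<^sup>2 = (norm x)\<^sup>2 + (norm y)\<^sup>2" by (simp add: z norm_Pair)
    show ?thesis
      using w unfolding F_def nz by (simp add: z power_mult_distrib add.assoc)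
  qed
  have C: "quat_mass / t\<^sup>2 \<noteq> 0" using t quat_mass_pos by simp
  have "integrable lborel (\<lambda>z. (1 / (quat_mass / t\<^sup>2)) *\<^sub>R (\<integral>c. F c z \<partial>lborel))"
    by (intro integrable_scaleR_right lborel_pair.integrable_snd[OF F_int])
  then show ?int
    unfolding inner scaleR_scaleR using C by (simp del: scaleR_scaleR)
  have "(\<integral>z. \<integral>c. F c z \<partial>lborel \<partial>lborel) = (\<integral>c. \<integral>z. F c z \<partial>lborel \<partial>lborel)"
    by (rule lborel_pair.Fubini_integral[OF F_int])
  also have "\<dots> = (\<integral>c. 0 \<partial>(lborel::quat measure))"
  proof (rule integral_cong_AE)
    have "(\<integral>z. F c z \<partial>lborel) = 0" if "c \<noteq> 0" for c
      using cross_line_weight(2)[OF fg that t lines[OF that]] by (simp add: F_def)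
    then show "AE c in lborel. (\<integral>z. F c z \<partial>lborel) = 0"
      using AE_lborel_singleton[of "0::quat"] by (auto elim!: eventually_mono)
  qed (use F_meas in measurable)
  finally show ?zero
    unfolding inner integral_scaleR_right using C by (simp del: scaleR_scaleR)
qed

section \<open>Averages over boxes\<close>

text \<open>\<open>ennreal\<close> truncates at 0, so the two densities are the positive and the
  negative part of u. Their measures agree and are finite on boxes, an intersection-stable
  generator, hence agree everywhere; equal densities mean that the two parts coincide, and both
  vanish.\<close>

lemma AE_zero_if_box_integrals_zero_real:
  fixes u :: "'a::euclidean_space \<Rightarrow> real"
  assumes [measurable]: "u \<in> borel_measurable borel"
    and int: "\<And>a b. integrable lborel (\<lambda>x. indicator (box a b) x * u x)"
    and zero: "\<And>a b. (\<integral>x. indicator (box a b) x * u x \<partial>lborel) = 0"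
  shows "AE x in lborel. u x = 0"
proof -
  have eq: "emeasure (density lborel (\<lambda>x. ennreal (u x))) (box a b) =
      emeasure (density lborel (\<lambda>x. ennreal (- u x))) (box a b)"
    and fin: "emeasure (density lborel (\<lambda>x. ennreal (u x))) (box a b) < \<infinity>" for a b
  proof -
    let ?h = "\<lambda>x. indicator (box a b) x * u x"
    have p: "emeasure (density lborel (\<lambda>x. ennreal (u x))) (box a b) = (\<integral>\<^sup>+x. ennreal (?h x) \<partial>lborel)"
      by (subst emeasure_density) (auto intro!: nn_integral_cong simp: indicator_def)
    have n: "emeasure (density lborel (\<lambda>x. ennreal (- u x))) (box a b) = (\<integral>\<^sup>+x. ennreal (- ?h x) \<partial>lborel)"
      by (subst emeasure_density) (auto intro!: nn_integral_cong simp: indicator_def)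
    have fp: "(\<integral>\<^sup>+x. ennreal (?h x) \<partial>lborel) < \<infinity>" and fn: "(\<integral>\<^sup>+x. ennreal (- ?h x) \<partial>lborel) < \<infinity>"
      using int[of a b] unfolding real_integrable_def by (auto simp: top.not_eq_extremum)
    have "enn2real (\<integral>\<^sup>+x. ennreal (?h x) \<partial>lborel) = enn2real (\<integral>\<^sup>+x. ennreal (- ?h x) \<partial>lborel)"
      using zero[of a b] unfolding real_lebesgue_integral_def[OF int[of a b]] by simp
    then have "(\<integral>\<^sup>+x. ennreal (?h x) \<partial>lborel) = (\<integral>\<^sup>+x. ennreal (- ?h x) \<partial>lborel)"
      using fp fn by (metis ennreal_enn2real infinity_ennreal_def)
    then show "emeasure (density lborel (\<lambda>x. ennreal (u x))) (box a b) =
      emeasure (density lborel (\<lambda>x. ennreal (- u x))) (box a b)"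
      "emeasure (density lborel (\<lambda>x. ennreal (u x))) (box a b) < \<infinity>"
      using fp by (simp_all add: p n)
  qed
  let ?E = "range (\<lambda>(a, b). box a b :: 'a set)"
  let ?A = "\<lambda>n::nat. box (- (real n *\<^sub>R One)) (real n *\<^sub>R One) :: 'a set"
  have "density lborel (\<lambda>x. ennreal (u x)) = density lborel (\<lambda>x. ennreal (- u x))"
  proof (rule measure_eqI_generator_eq)
    show "Int_stable ?E"
      by (auto simp: Int_stable_def box_Int_box)
    show "?E \<subseteq> Pow UNIV" "sets (density lborel (\<lambda>x. ennreal (u x))) = sigma_sets UNIV ?E"
      "sets (density lborel (\<lambda>x. ennreal (- u x))) = sigma_sets UNIV ?E"
      by (simp_all add: borel_eq_box)
    show "range ?A \<subseteq> ?E" "(\<Union>i. ?A i) = UNIV"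
      unfolding UN_box_eq_UNIV by auto
    show "emeasure (density lborel (\<lambda>x. ennreal (u x))) (?A i) \<noteq> \<infinity>" for i
      using fin by (metis less_irrefl)
    show "emeasure (density lborel (\<lambda>x. ennreal (u x))) X = emeasure (density lborel (\<lambda>x. ennreal (- u x))) X" if "X \<in> ?E" for X
      using that eq by auto
  qed
  then have "AE x in lborel. ennreal (u x) = ennreal (- u x)"
    by (intro sigma_finite_measure.density_unique[OF sigma_finite_lborel]) auto
  then show ?thesis
  proof eventually_elim
    case (elim x)
    then show ?case
      by (cases "0 \<le> u x") (auto simp: ennreal_neg ennreal_eq_0_iff dest: sym[of 0])
  qed
qed

lemma AE_zero_if_box_integrals_zero:
  fixes u :: "'a::euclidean_space \<Rightarrow> 'b::euclidean_space"
  assumes [measurable]: "u \<in> borel_measurable borel"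
    and int: "\<And>a b. integrable lborel (\<lambda>x. indicator (box a b) x *\<^sub>R u x)"
    and zero: "\<And>a b. (\<integral>x. indicator (box a b) x *\<^sub>R u x \<partial>lborel) = 0"
  shows "AE x in lborel. u x = 0"
proof -
  have "AE x in lborel. u x \<bullet> i = 0" for i
  proof (rule AE_zero_if_box_integrals_zero_real)
    fix a b :: 'a
    have *: "indicator (box a b) x * (u x \<bullet> i) = (indicator (box a b) x *\<^sub>R u x) \<bullet> i" for x
      by simp
    show "integrable lborel (\<lambda>x. indicator (box a b) x * (u x \<bullet> i))"
      unfolding * by (intro integrable_inner_left int)
    show "(\<integral>x. indicator (box a b) x * (u x \<bullet> i) \<partial>lborel) = 0"
      unfolding * using zero[of a b] by (subst integral_inner_left) (auto simp: int)
  qed measurable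
  then have "AE x in lborel. \<forall>i\<in>Basis. u x \<bullet> i = 0"
    by (intro AE_finite_allI) auto
  then show ?thesis
    by eventually_elim (simp add: euclidean_all_zero_iff)
qed

text \<open>From s \<le> 1 + s^2. The explicit bound does not change when \<tau> is translated,
  which gives the uniform bound on \<open>T\<close> in
  \<open>box_integral_zero_of_kernel\<close>.\<close>

lemma integrable_indicator_of_square_integrable:
  fixes \<tau> :: "'a::euclidean_space \<Rightarrow> 'b::{banach, second_countable_topology}"
  assumes [measurable]: "\<tau> \<in> borel_measurable borel" "S \<in> sets borel"
    and sq: "integrable lborel (\<lambda>z. (norm (\<tau> z))\<^sup>2)" and S: "emeasure lborel S < \<infinity>"
  shows "integrable lborel (\<lambda>z. indicator S z *\<^sub>R \<tau> z)"
    and "(\<integral>\<^sup>+z. ennreal (indicator S z * norm (\<tau> z)) \<partial>lborel) \<le>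
      emeasure lborel S + ennreal (\<integral>z. (norm (\<tau> z))\<^sup>2 \<partial>lborel)" (is ?bound)
proof -
  have "(\<integral>\<^sup>+z. ennreal (indicator S z * norm (\<tau> z)) \<partial>lborel) \<le>
      (\<integral>\<^sup>+z. indicator S z + ennreal ((norm (\<tau> z))\<^sup>2) \<partial>lborel)"
  proof (rule nn_integral_mono)
    fix z
    have "norm (\<tau> z) \<le> 1 + (norm (\<tau> z))\<^sup>2"
      using sum_squares_bound[of 1 "norm (\<tau> z)"] norm_ge_zero[of "\<tau> z"]
      unfolding one_power2 mult_1_right by linarith
    then have "ennreal (norm (\<tau> z)) \<le> 1 + ennreal ((norm (\<tau> z))\<^sup>2)"
      by (metis ennreal_1 ennreal_leI ennreal_plus zero_le_one zero_le_power2)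
    then show "ennreal (indicator S z * norm (\<tau> z)) \<le> indicator S z + ennreal ((norm (\<tau> z))\<^sup>2)"
      by (simp add: indicator_def)
  qed
  also have "\<dots> = emeasure lborel S + ennreal (\<integral>z. (norm (\<tau> z))\<^sup>2 \<partial>lborel)"
    using sq by (subst nn_integral_add) (auto simp: nn_integral_eq_integral)
  finally show b: ?bound .
  show "integrable lborel (\<lambda>z. indicator S z *\<^sub>R \<tau> z)"
    using S by (intro integrableI_bounded) (auto intro!: le_less_trans[OF b])
qed

text \<open>Since \<tau> has no continuity, the translation is moved onto the box. The indicators
  converge away from the boundary, a null set, and a ball containing all the translated boxes gives
  the dominating function.\<close>

lemma tendsto_box_translate_integral:
  fixes \<tau> :: "'a::euclidean_space \<Rightarrow> 'b::{banach, second_countable_topology}"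
  assumes [measurable]: "\<tau> \<in> borel_measurable borel"
    and sq: "integrable lborel (\<lambda>z. (norm (\<tau> z))\<^sup>2)" and s: "s \<longlonglongrightarrow> 0"
  shows "(\<lambda>n. \<integral>v. indicator (box a b) v *\<^sub>R \<tau> (s n + v) \<partial>lborel) \<longlonglongrightarrow> (\<integral>v. indicator (box a b) v *\<^sub>R \<tau> v \<partial>lborel)"
proof -
  have shift: "(\<integral>v. indicator (box a b) v *\<^sub>R \<tau> (s n + v) \<partial>lborel) = (\<integral>u. indicator (box a b) (u - s n) *\<^sub>R \<tau> u \<partial>lborel)" for n
    using integral_lborel_shift[of "\<lambda>u. indicator (box a b) (u - s n) *\<^sub>R \<tau> u" "s n"] by simp
  obtain R1 where R1: "\<And>x. x \<in> box a b \<Longrightarrow> norm x \<le> R1"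
    using bounded_box[of a b] unfolding bounded_iff by blast
  have "Bseq s" using s by (intro convergent_imp_Bseq) (auto simp: convergent_def)
  then obtain R2 where R2: "\<And>n. norm (s n) \<le> R2" by (auto simp: Bseq_def)
  show ?thesis
    unfolding shift
  proof (rule integral_dominated_convergence)
    show "integrable lborel (\<lambda>z. norm (indicator (cball 0 (R1 + R2)) z *\<^sub>R \<tau> z))"
      by (intro integrable_norm integrable_indicator_of_square_integrable sq emeasure_lborel_cball_finite) auto
    show "AE u in lborel. norm (indicator (box a b) (u - s n) *\<^sub>R \<tau> u) \<le> norm (indicator (cball 0 (R1 + R2)) u *\<^sub>R \<tau> u)" for n
    proof (intro AE_I2)
      fix u
      have "norm u \<le> R1 + R2" if "u - s n \<in> box a b"
        using R1[OF that] R2[of n] norm_triangle_ineq[of "u - s n" "s n"] by simp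
      then show "norm (indicator (box a b) (u - s n) *\<^sub>R \<tau> u) \<le> norm (indicator (cball 0 (R1 + R2)) u *\<^sub>R \<tau> u)"
        by (auto simp: indicator_def)
    qed
    have "AE u in lborel. u \<notin> cbox a b - box a b"
      by (rule AE_not_in[OF null_sets_cbox_Diff_box])
    then show "AE u in lborel. (\<lambda>n. indicator (box a b) (u - s n) *\<^sub>R \<tau> u) \<longlonglongrightarrow> indicator (box a b) u *\<^sub>R \<tau> u"
    proof eventually_elim
      case (elim u)
      have lim: "(\<lambda>n. u - s n) \<longlonglongrightarrow> u"
        using tendsto_diff[OF tendsto_const s, of u] by simp
      consider "u \<in> box a b" | "u \<in> - cbox a b" using elim by auto
      then have "eventually (\<lambda>n. indicator (box a b) (u - s n) *\<^sub>R \<tau> u = indicator (box a b) u *\<^sub>R \<tau> u) sequentially"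
      proof cases
        case 1
        then have "eventually (\<lambda>n. u - s n \<in> box a b) sequentially"
          by (intro topological_tendstoD[OF lim]) auto
        then show ?thesis by eventually_elim (use 1 in simp)
      next
        case 2
        then have "eventually (\<lambda>n. u - s n \<in> - cbox a b) sequentially"
          by (intro topological_tendstoD[OF lim]) (auto simp: closed_cbox)
        then show ?thesis by eventually_elim (use 2 box_subset_cbox[of a b] in \<open>auto simp: indicator_def\<close>)
      qed
      then show ?case by (rule tendsto_eventually)
    qed
  qed measurable
qed

text \<open>An approximate identity argument after smoothing: \<open>T z\<close>, the integral of
  \<tau> over the box moved by z, is bounded and sequentially continuous at 0 although \<tau> need
  not be. By Fubini the integral of K(w) T(e w) vanishes for every e > 0; letting e tend to 0 leaves
  T(0) times the nonzero mass of K.\<close>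

lemma box_integral_zero_of_kernel:
  fixes \<tau> :: "'a::euclidean_space \<Rightarrow> 'b::{banach, second_countable_topology}" and K :: "'a \<Rightarrow> real"
  assumes [measurable]: "\<tau> \<in> borel_measurable borel"
    and sq: "integrable lborel (\<lambda>z. (norm (\<tau> z))\<^sup>2)"
    and K: "integrable lborel K" "(\<integral>w. K w \<partial>lborel) \<noteq> 0"
    and zero: "\<And>e v. e > 0 \<Longrightarrow> (\<integral>w. K w *\<^sub>R \<tau> (e *\<^sub>R w + v) \<partial>lborel) = 0"
  shows "(\<integral>v. indicator (box a b) v *\<^sub>R \<tau> v \<partial>lborel) = 0"
proof -
  have [measurable]: "K \<in> borel_measurable borel" using borel_measurable_integrable[OF K(1)] by simp
  define T where "T = (\<lambda>z. \<integral>v. indicator (box a b) v *\<^sub>R \<tau> (z + v) \<partial>lborel)"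
  define M where "M = measure lborel (box a b) + (\<integral>z. (norm (\<tau> z))\<^sup>2 \<partial>lborel)"
  have M0: "M \<ge> 0" by (simp add: M_def)
  have nn: "(\<integral>\<^sup>+v. ennreal (indicator (box a b) v * norm (\<tau> (z + v))) \<partial>lborel) \<le> ennreal M" for z
  proof -
    have "(\<integral>\<^sup>+v. ennreal (indicator (box a b) v * norm (\<tau> (z + v))) \<partial>lborel) \<le>
      emeasure lborel (box a b) + ennreal (\<integral>v. (norm (\<tau> (z + v)))\<^sup>2 \<partial>lborel)"
      by (rule integrable_indicator_of_square_integrable(2))
        (use integrable_lborel_shift[OF sq] emeasure_lborel_box_finite[of a b] in auto)
    also have "(\<integral>v. (norm (\<tau> (z + v)))\<^sup>2 \<partial>lborel) = (\<integral>v. (norm (\<tau> v))\<^sup>2 \<partial>lborel)"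
      by (rule integral_lborel_shift) measurable
    also have "emeasure lborel (box a b) = ennreal (measure lborel (box a b))"
      using emeasure_lborel_box_finite[of a b] by (intro emeasure_eq_ennreal_measure) auto
    finally show ?thesis by (simp add: M_def)
  qed
  have T_bound: "norm (T z) \<le> M" for z
  proof -
    have "norm (T z) \<le> (\<integral>\<^sup>+v. ennreal (norm (indicator (box a b) v *\<^sub>R \<tau> (z + v))) \<partial>lborel)"
      unfolding T_def by (rule integral_norm_bound_ennreal)
        (rule integrable_indicator_of_square_integrable(1), use integrable_lborel_shift[OF sq] emeasure_lborel_box_finite[of a b] in auto)
    also have "\<dots> \<le> ennreal M" using nn[of z] by simp
    finally show ?thesis using M0 by simp
  qed
  have KT: "(\<integral>w. K w *\<^sub>R T (e *\<^sub>R w) \<partial>lborel) = 0" if e: "e > 0" for e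
  proof -
    define F where "F = (\<lambda>w v. (K w * indicator (box a b) v) *\<^sub>R \<tau> (e *\<^sub>R w + v))"
    have F_meas: "(\<lambda>(w, v). F w v) \<in> borel_measurable (lborel \<Otimes>\<^sub>M lborel)"
      unfolding F_def by measurable
    have "(\<integral>\<^sup>+wv. ennreal (norm (case wv of (w, v) \<Rightarrow> F w v)) \<partial>(lborel \<Otimes>\<^sub>M lborel)) =
      (\<integral>\<^sup>+w. \<integral>\<^sup>+v. ennreal (norm (F w v)) \<partial>lborel \<partial>lborel)"
      using F_meas by (subst lborel.nn_integral_fst[symmetric]) auto
    also have "\<dots> \<le> (\<integral>\<^sup>+w. ennreal (norm (K w)) * ennreal M \<partial>lborel)"
    proof (rule nn_integral_mono)
      fix w
      have "(\<integral>\<^sup>+v. ennreal (norm (F w v)) \<partial>lborel) =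
        (\<integral>\<^sup>+v. ennreal (norm (K w)) * ennreal (indicator (box a b) v * norm (\<tau> (e *\<^sub>R w + v))) \<partial>lborel)"
        by (intro nn_integral_cong) (simp add: F_def abs_mult mult.assoc flip: ennreal_mult)
      also have "\<dots> = ennreal (norm (K w)) * (\<integral>\<^sup>+v. ennreal (indicator (box a b) v * norm (\<tau> (e *\<^sub>R w + v))) \<partial>lborel)"
        by (rule nn_integral_cmult) measurable
      finally show "(\<integral>\<^sup>+v. ennreal (norm (F w v)) \<partial>lborel) \<le> ennreal (norm (K w)) * ennreal M"
        using nn by (simp add: mult_left_mono)
    qed
    also have "\<dots> = (\<integral>\<^sup>+w. ennreal (norm (K w)) \<partial>lborel) * ennreal M"
      by (rule nn_integral_multc) measurable
    also have "\<dots> < \<infinity>"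
      using K(1) by (auto simp: integrable_iff_bounded ennreal_mult_less_top)
    finally have F_int: "integrable (lborel \<Otimes>\<^sub>M lborel) (\<lambda>(w, v). F w v)"
      using F_meas by (intro integrableI_bounded)
    have "(\<integral>w. K w *\<^sub>R T (e *\<^sub>R w) \<partial>lborel) = (\<integral>w. \<integral>v. F w v \<partial>lborel \<partial>lborel)"
      by (simp add: T_def F_def flip: scaleR_scaleR)
    also have "\<dots> = (\<integral>v. \<integral>w. F w v \<partial>lborel \<partial>lborel)"
      by (rule lborel_pair.Fubini_integral[OF F_int, symmetric])
    also have "\<dots> = 0"
      by (simp add: F_def zero[OF e] mult.commute[of "K _"] flip: scaleR_scaleR)
    finally show ?thesis .
  qed
  have "(\<lambda>n. \<integral>w. K w *\<^sub>R T ((1 / real (Suc n)) *\<^sub>R w) \<partial>lborel) \<longlonglongrightarrow> (\<integral>w. K w *\<^sub>R T 0 \<partial>lborel)"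
  proof (rule integral_dominated_convergence)
    show "integrable lborel (\<lambda>w. norm (K w) * M)"
      using K by auto
    show "AE w in lborel. norm (K w *\<^sub>R T ((1 / real (Suc n)) *\<^sub>R w)) \<le> norm (K w) * M" for n
      using T_bound by (auto intro!: mult_left_mono)
    have "(\<lambda>n. T ((1 / real (Suc n)) *\<^sub>R w)) \<longlonglongrightarrow> T 0" for w
    proof -
      have "(\<lambda>n. (1 / real (Suc n)) *\<^sub>R w) \<longlonglongrightarrow> 0 *\<^sub>R w"
        by (intro tendsto_intros LIMSEQ_Suc lim_1_over_n)
      then show ?thesis
        unfolding T_def using tendsto_box_translate_integral[OF _ sq, of "\<lambda>n. (1 / real (Suc n)) *\<^sub>R w" a b] by simp
    qed
    then show "AE w in lborel. (\<lambda>n. K w *\<^sub>R T ((1 / real (Suc n)) *\<^sub>R w)) \<longlonglongrightarrow> K w *\<^sub>R T 0"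
      by (intro AE_I2 tendsto_intros)
    have [measurable]: "T \<in> borel_measurable borel"
      unfolding T_def by measurable
    show "(\<lambda>w. K w *\<^sub>R T ((1 / real (Suc n)) *\<^sub>R w)) \<in> borel_measurable lborel" for n by measurable
  qed measurable
  then have "(\<integral>w. K w *\<^sub>R T 0 \<partial>lborel) = 0"
    by (simp add: KT LIMSEQ_const_iff)
  then show ?thesis
    using K by (simp add: T_def)
qed

section \<open>Vanishing of the line transform\<close>

text \<open>
  \<open>(1 + |w|\<^sup>2)\<^sup>-\<^sup>2\<close> is not integrable on \<open>\<real>\<^sup>8\<close>, whereas its third difference decays like \<open>|w|\<^sup>-\<^sup>1\<^sup>0\<close>.
\<close>

definition diff_kernel :: "quat \<times> quat \<Rightarrow> real" where
  "diff_kernel w = 1 / (1 + (norm w)\<^sup>2)\<^sup>2 - 3 / (2 + (norm w)\<^sup>2)\<^sup>2 + 3 / (3 + (norm w)\<^sup>2)\<^sup>2 - 1 / (4 + (norm w)\<^sup>2)\<^sup>2"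

lemma diff_kernel_measurable [measurable]: "diff_kernel \<in> borel_measurable borel"
  unfolding diff_kernel_def[abs_def] by measurable

text \<open>Over the common denominator the terms of degree 6, 5 and 4 cancel and a cubic with
  positive coefficients remains, against a denominator of degree 8.\<close>

lemma third_difference_inverse_square:
  fixes A :: real
  assumes A: "A \<ge> 1"
  defines "k \<equiv> 1 / A\<^sup>2 - 3 / (A + 1)\<^sup>2 + 3 / (A + 2)\<^sup>2 - 1 / (A + 3)\<^sup>2"
  shows "0 < k" "k \<le> 300 / A ^ 5"
proof -
  \<comment> \<open>The coefficients add up to 300, the constant of the upper bound, because A \<ge>
    1.\<close>
  define N where "N = 24 * A ^ 3 + 108 * A\<^sup>2 + 132 * A + 36"
  define P where "P = A\<^sup>2 * (A + 1)\<^sup>2 * (A + 2)\<^sup>2 * (A + 3)\<^sup>2"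
  have P: "P > 0" using A by (simp add: P_def)
  have "k * P = (A + 1)\<^sup>2 * (A + 2)\<^sup>2 * (A + 3)\<^sup>2 - 3 * A\<^sup>2 * (A + 2)\<^sup>2 * (A + 3)\<^sup>2
      + 3 * A\<^sup>2 * (A + 1)\<^sup>2 * (A + 3)\<^sup>2 - A\<^sup>2 * (A + 1)\<^sup>2 * (A + 2)\<^sup>2"
    using A by (simp add: k_def P_def left_diff_distrib distrib_right)
  also have "\<dots> = N"
    unfolding N_def by algebra
  finally have k: "k = N / P" using P by (simp add: field_simps)
  have N: "N > 0" using A by (simp add: N_def add_pos_nonneg)
  then show "0 < k" using P by (simp add: k)
  have "A\<^sup>2 \<le> A ^ 3" "A \<le> A ^ 3" "1 \<le> A ^ 3"
    using A power_increasing[of 2 3 A] power_increasing[of 1 3 A] by (simp_all add: one_le_power)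
  then have "N \<le> 300 * A ^ 3" by (simp add: N_def)
  moreover have "A\<^sup>2 * A\<^sup>2 * A\<^sup>2 * A\<^sup>2 \<le> P"
    unfolding P_def using A by (intro mult_mono power_mono) auto
  ultimately have "N / P \<le> 300 * A ^ 3 / (A\<^sup>2 * A\<^sup>2 * A\<^sup>2 * A\<^sup>2)"
    using A N by (intro frac_le) auto
  also have "\<dots> = 300 / A ^ 5"
    using A by (simp add: field_simps power_numeral_reduce)
  finally show "k \<le> 300 / A ^ 5" by (simp add: k)
qed

lemma diff_kernel_bounds: "0 < diff_kernel w" "diff_kernel w \<le> 300 * (1 / (1 + (norm w)\<^sup>2) ^ 5)"
  using third_difference_inverse_square[of "1 + (norm w)\<^sup>2"]
  by (simp_all add: diff_kernel_def algebra_simps)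

lemma integrable_diff_kernel: "integrable lborel diff_kernel"
proof (rule Bochner_Integration.integrable_bound)
  have "(\<integral>\<^sup>+z. ennreal (1 / (1 + (norm z)\<^sup>2) ^ 5) \<partial>(lborel :: (quat \<times> quat) measure)) < \<infinity>"
    by (rule nn_integral_inverse_power_finite) simp
  then show "integrable lborel (\<lambda>w :: quat \<times> quat. 300 * (1 / (1 + (norm w)\<^sup>2) ^ 5))"
    by (intro integrable_mult_right integrableI_nonneg) auto
  show "AE w in lborel. norm (diff_kernel w) \<le> norm (300 * (1 / (1 + (norm w)\<^sup>2) ^ 5))"
    using diff_kernel_bounds by (intro AE_I2) (smt (verit) real_norm_def)
qed measurable

lemma integral_diff_kernel_nonzero: "(\<integral>w. diff_kernel w \<partial>lborel) \<noteq> 0"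
proof
  assume "(\<integral>w. diff_kernel w \<partial>lborel) = 0"
  then have "(\<integral>\<^sup>+w. ennreal (diff_kernel w) \<partial>lborel) = 0"
    using diff_kernel_bounds(1)
    by (subst nn_integral_eq_integral) (auto simp: integrable_diff_kernel intro!: less_imp_le simp del: split_paired_All)
  moreover have "(\<integral>\<^sup>+w. ennreal (diff_kernel w) \<partial>lborel) > 0"
    by (intro nn_integral_pos_lborel diff_kernel_bounds) measurable
  ultimately show False by simp
qed

lemma sq_integrable_shift: "sq_integrable f \<Longrightarrow> sq_integrable (\<lambda>x. f (x + d))"
  using sq_integrable_affine[of f 1 "- d"] by simp

lemma integrable_norm_cross_square:
  assumes "sq_integrable f" "sq_integrable g"
  shows "integrable lborel (\<lambda>z. (norm (cross f g z))\<^sup>2)"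
proof (rule integrableI_bounded)
  have [measurable]: "f \<in> borel_measurable borel" "g \<in> borel_measurable borel"
    using assms by (auto intro: sq_integrable_measurable)
  show "(\<lambda>z. (norm (cross f g z))\<^sup>2) \<in> borel_measurable lborel" by measurable
  have "(\<integral>\<^sup>+z. ennreal (norm ((norm (cross f g z))\<^sup>2)) \<partial>lborel) =
      (\<integral>\<^sup>+x. \<integral>\<^sup>+y. ennreal ((norm (f x))\<^sup>2) * ennreal ((norm (g y))\<^sup>2) \<partial>lborel \<partial>lborel)"
    by (subst nn_integral_lborel_prod_fst, measurable) (simp add: norm_cross power_mult_distrib ennreal_mult)
  also have "\<dots> < \<infinity>"
    by (simp add: nn_integral_cmult nn_integral_multc nn_integral_norm_square assms ennreal_mult_less_top)
  finally show "(\<integral>\<^sup>+z. ennreal (norm ((norm (cross f g z))\<^sup>2)) \<partial>lborel) < \<infinity>" .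
qed

text \<open>The family of lines is stable under the affine maps involved: translation by (d, d')
  keeps the slope c and changes the offset p to p + d + c d', and dilation by e only rescales the
  parameter t. So each of the four terms of the kernel vanishes separately.\<close>

lemma cross_diff_kernel:
  fixes f g :: "quat \<Rightarrow> quat"
  assumes fg: "sq_integrable f" "sq_integrable g" and e: "e > 0"
    and lines: "\<And>c p. c \<noteq> 0 \<Longrightarrow> (\<integral>y. quat_cnj (f (p - c * y)) * g y \<partial>lborel) = 0"
  shows "(\<integral>w. diff_kernel w *\<^sub>R cross f g (e *\<^sub>R w + v) \<partial>lborel) = 0"
proof -
  have [measurable]: "f \<in> borel_measurable borel" "g \<in> borel_measurable borel"
    using assms by (auto intro: sq_integrable_measurable)
  obtain d d' where v: "v = (d, d')" by (cases v)
  define G where "G = cross (\<lambda>x. f (x + d)) (\<lambda>y. g (y + d'))"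
  have G: "G z = cross f g (z + v)" for z by (simp add: G_def cross_def v)
  have [measurable]: "G \<in> borel_measurable borel" unfolding G_def by measurable
  have lines': "(\<integral>y. quat_cnj (f (p - c * y + d)) * g (y + d') \<partial>lborel) = 0" if "c \<noteq> 0" for c p
  proof -
    have "(\<integral>y. quat_cnj (f (p - c * y + d)) * g (y + d') \<partial>lborel) =
      (\<integral>y. quat_cnj (f ((p + d + c * d') - c * (d' + y))) * g (d' + y) \<partial>lborel)"
      by (intro Bochner_Integration.integral_cong) (simp_all add: algebra_simps)
    also have "\<dots> = (\<integral>y. quat_cnj (f ((p + d + c * d') - c * y)) * g y \<partial>lborel)"
      by (rule integral_lborel_shift[of "\<lambda>y. quat_cnj (f ((p + d + c * d') - c * y)) * g y"]) measurable
    also have "\<dots> = 0" by (rule lines[OF that])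
    finally show ?thesis .
  qed
  have j: "integrable lborel (\<lambda>w. (1 / (j + (norm w)\<^sup>2)\<^sup>2) *\<^sub>R G (e *\<^sub>R w))"
    and j0: "(\<integral>w. (1 / (j + (norm w)\<^sup>2)\<^sup>2) *\<^sub>R G (e *\<^sub>R w) \<partial>lborel) = 0" if "j > 0" for j :: real
  proof -
    \<comment> \<open>The parameter \<open>j * e\<^sup>2\<close> makes the kernel at
      \<open>e *\<^sub>R w\<close> equal to e^-4 times the one with parameter \<open>j\<close> at
      \<open>w\<close>.\<close>
    define h where "h = (\<lambda>z. (1 / (j * e\<^sup>2 + (norm z)\<^sup>2)\<^sup>2) *\<^sub>R G z)"
    have [measurable]: "h \<in> borel_measurable borel" unfolding h_def by measurable
    have je: "j * e\<^sup>2 > 0" using that e by simp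
    have h: "integrable lborel h" "(\<integral>z. h z \<partial>lborel) = 0"
      unfolding h_def G_def using fg je lines'
      by (auto intro!: cross_inverse_square sq_integrable_shift)
    have eq: "(1 / (j + (norm w)\<^sup>2)\<^sup>2) *\<^sub>R G (e *\<^sub>R w) = e ^ 4 *\<^sub>R h (e *\<^sub>R w)" for w
    proof -
      have "j * e\<^sup>2 + (norm (e *\<^sub>R w))\<^sup>2 = e\<^sup>2 * (j + (norm w)\<^sup>2)"
        by (simp add: power_mult_distrib algebra_simps)
      then show ?thesis using e by (simp add: h_def power_mult_distrib)
    qed
    show "integrable lborel (\<lambda>w. (1 / (j + (norm w)\<^sup>2)\<^sup>2) *\<^sub>R G (e *\<^sub>R w))"
      unfolding eq using integrable_lborel_affine[OF h(1), of e 0] e by (intro integrable_scaleR_right) simp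
    show "(\<integral>w. (1 / (j + (norm w)\<^sup>2)\<^sup>2) *\<^sub>R G (e *\<^sub>R w) \<partial>lborel) = 0"
      unfolding eq using integral_lborel_affine[of h e 0] e h(2) by simp
  qed
  have "diff_kernel w *\<^sub>R cross f g (e *\<^sub>R w + v) =
      (1 / (1 + (norm w)\<^sup>2)\<^sup>2) *\<^sub>R G (e *\<^sub>R w) - 3 *\<^sub>R (1 / (2 + (norm w)\<^sup>2)\<^sup>2) *\<^sub>R G (e *\<^sub>R w) +
      3 *\<^sub>R (1 / (3 + (norm w)\<^sup>2)\<^sup>2) *\<^sub>R G (e *\<^sub>R w) - (1 / (4 + (norm w)\<^sup>2)\<^sup>2) *\<^sub>R G (e *\<^sub>R w)" for w
    by (simp add: diff_kernel_def G scaleR_diff_left scaleR_add_left)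
  then show ?thesis
    using j[of 1] j[of 2] j[of 3] j[of 4] j0[of 1] j0[of 2] j0[of 3] j0[of 4]
    by (simp del: scaleR_scaleR)
qed

lemma box_Pair: "box (a, a') (b, b') = box a b \<times> box a' b'"
  by (auto simp: box_def Basis_prod_def ball_Un)

text \<open>On a product box the integral of \<open>cross\<close> is the product of two quaternions.
  There are no zero divisors, so one nonzero box integral of g forces all box integrals of the
  conjugate of f to vanish.\<close>

lemma AE_zero_of_line_integrals_zero:
  fixes f g :: "quat \<Rightarrow> quat"
  assumes fg: "sq_integrable f" "sq_integrable g"
    and lines: "\<And>c p. c \<noteq> 0 \<Longrightarrow> (\<integral>y. quat_cnj (f (p - c * y)) * g y \<partial>lborel) = 0"
  shows "(AE x in lborel. f x = 0) \<or> (AE x in lborel. g x = 0)"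
proof -
  have [measurable]: "f \<in> borel_measurable borel" "g \<in> borel_measurable borel"
    using assms by (auto intro: sq_integrable_measurable)
  have fg2: "integrable lborel (\<lambda>x. (norm (quat_cnj (f x)))\<^sup>2)" "integrable lborel (\<lambda>x. (norm (g x))\<^sup>2)"
    using fg by (auto simp: sq_integrable_def)
  have int_f: "integrable lborel (\<lambda>x. indicator (box a b) x *\<^sub>R quat_cnj (f x))" for a b
    by (rule integrable_indicator_of_square_integrable) (use fg2 emeasure_lborel_box_finite[of a b] in auto)
  have int_g: "integrable lborel (\<lambda>x. indicator (box a b) x *\<^sub>R g x)" for a b
    by (rule integrable_indicator_of_square_integrable) (use fg2 emeasure_lborel_box_finite[of a b] in auto)
  have prod: "(\<integral>x. indicator (box a b) x *\<^sub>R quat_cnj (f x) \<partial>lborel) * (\<integral>y. indicator (box a' b') y *\<^sub>R g y \<partial>lborel) = 0" for a b a' b'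
  proof -
    let ?Q = "box (a, a') (b, b')" and ?J = "\<integral>y. indicator (box a' b') y *\<^sub>R g y \<partial>lborel"
    have "(\<integral>x. indicator (box a b) x *\<^sub>R quat_cnj (f x) \<partial>lborel) * ?J = (\<integral>x. (indicator (box a b) x *\<^sub>R quat_cnj (f x)) * ?J \<partial>lborel)"
      by (rule Bochner_Integration.integral_mult_left[symmetric]) (rule int_f)
    also have "\<dots> = (\<integral>x. \<integral>y. (indicator (box a b) x *\<^sub>R quat_cnj (f x)) * (indicator (box a' b') y *\<^sub>R g y) \<partial>lborel \<partial>lborel)"
      by (intro Bochner_Integration.integral_cong refl Bochner_Integration.integral_mult_right[symmetric] int_g)
    also have "\<dots> = (\<integral>x. \<integral>y. indicator ?Q (x, y) *\<^sub>R cross f g (x, y) \<partial>lborel \<partial>lborel)"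
      by (intro Bochner_Integration.integral_cong) (simp_all add: box_Pair cross_def indicator_times)
    also have "\<dots> = (\<integral>z. indicator ?Q z *\<^sub>R cross f g z \<partial>(lborel \<Otimes>\<^sub>M lborel))"
    proof (rule lborel_pair.integral_fst')
      show "integrable (lborel \<Otimes>\<^sub>M lborel) (\<lambda>z. indicator ?Q z *\<^sub>R cross f g z)"
        unfolding lborel_prod using emeasure_lborel_box_finite[of "(a, a')" "(b, b')"]
        by (intro integrable_indicator_of_square_integrable integrable_norm_cross_square fg) auto
    qed
    also have "\<dots> = 0"
      unfolding lborel_prod
      by (rule box_integral_zero_of_kernel[OF _ integrable_norm_cross_square[OF fg] integrable_diff_kernel integral_diff_kernel_nonzero])
        (auto intro!: cross_diff_kernel fg lines)
    finally show ?thesis .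
  qed
  show ?thesis
  proof (cases "\<forall>a b. (\<integral>y. indicator (box a b) y *\<^sub>R g y \<partial>lborel) = 0")
    case True
    then show ?thesis
      using AE_zero_if_box_integrals_zero[OF _ int_g] by simp
  next
    case False
    then have "(\<integral>x. indicator (box a b) x *\<^sub>R quat_cnj (f x) \<partial>lborel) = 0" for a b
      using prod by auto
    then have "AE x in lborel. quat_cnj (f x) = 0"
      using AE_zero_if_box_integrals_zero[OF _ int_f] by simp
    then have "AE x in lborel. f x = 0"
      by eventually_elim (metis norm_eq_zero quat_norm_cnj)
    then show ?thesis ..
  qed
qed

section \<open>Completeness and orthogonal complements\<close>

text \<open>The vector is G - P, where P is a point of S nearest to G. A minimizing sequence is
  Cauchy by the parallelogram law, as midpoints stay in S.\<close>

lemma closed_subspace_orthogonal_complement_nontrivial: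
  fixes S :: "'a::{real_inner, complete_space} set"
  assumes closed: "closed S" and S: "subspace S" and G: "G \<notin> S"
  obtains H where "H \<noteq> 0" "\<And>F. F \<in> S \<Longrightarrow> inner F H = 0"
proof -
  define D where "D = (\<lambda>F. (norm (G - F))\<^sup>2)"
  define d where "d = (INF F\<in>S. D F)"
  have bdd: "bdd_below (D ` S)" by (intro bdd_belowI[of _ 0]) (auto simp: D_def)
  have S0: "0 \<in> S" using S by (rule subspace_0)
  have d_le: "d \<le> D F" if "F \<in> S" for F
    unfolding d_def using bdd that by (rule cINF_lower)
  have "\<exists>F\<in>S. D F < d + 1 / real (Suc n)" for n
  proof (rule ccontr)
    assume "\<not> (\<exists>F\<in>S. D F < d + 1 / real (Suc n))"
    then have "d + 1 / real (Suc n) \<le> d"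
      unfolding d_def using S0 by (intro cINF_greatest) (auto simp: not_less d_def)
    then show False by simp
  qed
  then obtain X where X: "\<And>n. X n \<in> S" "\<And>n. D (X n) < d + 1 / real (Suc n)" by metis
  have parallelogram: "(norm (E - F))\<^sup>2 \<le> 2 * (D E - d) + 2 * (D F - d)" if "E \<in> S" "F \<in> S" for E F
  proof -
    have "(1 / 2) *\<^sub>R (E + F) \<in> S" using that S by (intro subspace_scale subspace_add)
    from d_le[OF this] have "4 * d \<le> 4 * D ((1 / 2) *\<^sub>R (E + F))" by simp
    also have "\<dots> = (norm (2 *\<^sub>R (G - (1 / 2) *\<^sub>R (E + F))))\<^sup>2"
      by (simp add: D_def power_mult_distrib)
    also have "2 *\<^sub>R (G - (1 / 2) *\<^sub>R (E + F)) = (G - E) + (G - F)"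
      by (simp add: algebra_simps scaleR_2)
    finally have "4 * d \<le> (norm ((G - E) + (G - F)))\<^sup>2" .
    moreover have "(norm ((G - E) + (G - F)))\<^sup>2 + (norm ((G - F) - (G - E)))\<^sup>2 = 2 * D E + 2 * D F"
      unfolding D_def power2_norm_eq_inner by (simp add: inner_add inner_diff inner_commute algebra_simps)
    moreover have "(G - F) - (G - E) = E - F" by simp
    ultimately show ?thesis by simp
  qed
  have "Cauchy X"
  proof (rule metric_CauchyI)
    fix e :: real assume e: "e > 0"
    obtain N where N: "4 / e\<^sup>2 < real N" using reals_Archimedean2 by blast
    have "dist (X m) (X n) < e" if "m \<ge> N" "n \<ge> N" for m n
    proof -
      have "N > 0" using N e by (cases N) (auto simp: not_less[symmetric])
      have *: "D (X k) - d < 1 / real N" if "k \<ge> N" for k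
      proof -
        have "1 / real (Suc k) \<le> 1 / real N" using that \<open>N > 0\<close> by (intro divide_left_mono) auto
        then show ?thesis using X(2)[of k] by linarith
      qed
      have "(norm (X m - X n))\<^sup>2 < 4 / real N"
        using parallelogram[OF X(1) X(1), of m n] *[OF that(1)] *[OF that(2)] by simp
      also have "\<dots> < e\<^sup>2" using N e \<open>N > 0\<close> by (simp add: field_simps)
      finally have "norm (X m - X n) < e" using e by (intro power2_less_imp_less[of _ e]) auto
      then show ?thesis by (simp add: dist_norm)
    qed
    then show "\<exists>M. \<forall>m\<ge>M. \<forall>n\<ge>M. dist (X m) (X n) < e" by blast
  qed
  then obtain P where P: "X \<longlonglongrightarrow> P" using Cauchy_convergent convergent_def by blast
  have PS: "P \<in> S" using closed_sequentially[OF closed _ P] X(1) by blast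
  have "(\<lambda>n. D (X n)) \<longlonglongrightarrow> D P" unfolding D_def by (intro tendsto_intros P)
  moreover have "(\<lambda>n. d + 1 / real (Suc n)) \<longlonglongrightarrow> d + 0"
    by (intro tendsto_intros LIMSEQ_Suc lim_1_over_n)
  ultimately have "D P \<le> d"
    using X(2) by (intro LIMSEQ_le[of "\<lambda>n. D (X n)" _ "\<lambda>n. d + 1 / real (Suc n)"]) (auto intro: less_imp_le)
  have orth: "inner F (G - P) = 0" if F: "F \<in> S" for F
  proof (cases "F = 0")
    case False
    \<comment> \<open>The minimizer of the quadratic function sending r to
      \<open>D (P + r *\<^sub>R F)\<close>.\<close>
    define r where "r = inner F (G - P) / inner F F"
    have FF: "inner F F > 0" using False by simp
    have "P + r *\<^sub>R F \<in> S" using PS F S by (intro subspace_add subspace_scale)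
    then have "D P \<le> D (P + r *\<^sub>R F)" using d_le \<open>D P \<le> d\<close> by fastforce
    also have "D (P + r *\<^sub>R F) = D P - 2 * r * inner F (G - P) + r * r * inner F F"
      unfolding D_def power2_norm_eq_inner by (simp add: inner_add inner_diff inner_commute algebra_simps)
    also have "\<dots> = D P - (inner F (G - P))\<^sup>2 / inner F F"
      using FF by (simp add: r_def power2_eq_square field_simps)
    finally have "(inner F (G - P))\<^sup>2 \<le> 0" using FF by (simp add: divide_le_0_iff)
    then show ?thesis by simp
  qed simp
  have "G - P \<noteq> 0" using PS G by auto
  then show ?thesis using that orth by blast
qed

section \<open>Riesz-Fischer: completeness of the quaternionic L^2 space\<close>

lemma norm_l2_quat_abs:
  assumes "sq_integrable f"
  shows "(norm (abs_l2_quat f))\<^sup>2 = (\<integral>x. (norm (f x))\<^sup>2 \<partial>lborel)"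
proof -
  have "l2_eq f f" using assms by (simp add: l2_eq_def)
  then have "quat_re (qinner (abs_l2_quat f) (abs_l2_quat f)) = (\<integral>x. inner (f x) (f x) \<partial>lborel)"
    by (simp add: qinner.abs_eq quat_re_l2_inner assms)
  moreover have "(norm (abs_l2_quat f))\<^sup>2 = quat_re (qinner (abs_l2_quat f) (abs_l2_quat f))"
    unfolding power2_norm_eq_inner inner_l2_quat_def ..
  ultimately show ?thesis by (simp add: power2_norm_eq_inner)
qed

lemma l2_quat_cases:
  obtains f where "F = abs_l2_quat f" "sq_integrable f"
  by (metis Quotient_l2_quat Quotient_abs_rep Quotient_rep_reflp l2_eq_sq_integrable)

lemma sq_integrable_diff:
  assumes "sq_integrable f" "sq_integrable g"
  shows "sq_integrable (\<lambda>x. f x - g x)"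
  using sq_integrable_add[OF assms(1) sq_integrable_scaleR[OF assms(2), of "-1"]]
  by (simp only: scaleR_minus1_left add_uminus_conv_diff)

lemma l2_quat_abs_diff:
  assumes "sq_integrable f" "sq_integrable g"
  shows "abs_l2_quat f - abs_l2_quat g = abs_l2_quat (\<lambda>x. f x - g x)"
proof -
  have eq: "l2_eq f f" "l2_eq g g" "l2_eq (\<lambda>x. (-1) *\<^sub>R g x) (\<lambda>x. (-1) *\<^sub>R g x)"
    using assms sq_integrable_scaleR[OF assms(2), of "-1"] unfolding l2_eq_def by blast+
  show ?thesis
    unfolding minus_l2_quat_def scaleR_l2_quat.abs_eq[OF eq(2)] plus_l2_quat.abs_eq[OF eq(1,3)]
    by (simp only: scaleR_minus1_left add_uminus_conv_diff)
qed

lemma two_mult_le_inverse_plus: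
  fixes a q :: real
  assumes "q > 0"
  shows "2 * a \<le> 1 / q + q * a\<^sup>2"
proof -
  have "0 \<le> (1 - q * a)\<^sup>2 / q" using assms by simp
  also have "\<dots> = 1 / q + q * a\<^sup>2 - 2 * a"
    using assms by (simp add: power2_eq_square field_simps)
  finally show ?thesis by simp
qed

text \<open>The weight 2^n sits between two scales: against 4^-n it leaves a convergent series, so
  the weighted squares of the increments are summable almost everywhere, and its reciprocal is
  summable too, so \<open>two_mult_le_inverse_plus\<close> with q = 2^n passes from the squares to
  the increments.\<close>

lemma AE_convergent_of_fast_Cauchy:
  fixes u :: "nat \<Rightarrow> quat \<Rightarrow> quat"
  assumes u: "\<And>n. sq_integrable (u n)"
    and fast: "\<And>n. (\<integral>x. (norm (u (Suc n) x - u n x))\<^sup>2 \<partial>lborel) \<le> (1 / 4) ^ n"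
  shows "AE x in lborel. convergent (\<lambda>n. u n x)"
proof -
  have [measurable]: "u n \<in> borel_measurable borel" for n using u by (rule sq_integrable_measurable)
  have "(\<integral>\<^sup>+x. (\<Sum>n. ennreal (2 ^ n) * ennreal ((norm (u (Suc n) x - u n x))\<^sup>2)) \<partial>lborel) =
      (\<Sum>n. \<integral>\<^sup>+x. ennreal (2 ^ n) * ennreal ((norm (u (Suc n) x - u n x))\<^sup>2) \<partial>lborel)"
    by (rule nn_integral_suminf) measurable
  also have "\<dots> \<le> (\<Sum>n. ennreal ((1 / 2) ^ n))"
  proof (rule suminf_le)
    fix n
    have "(\<integral>\<^sup>+x. ennreal (2 ^ n) * ennreal ((norm (u (Suc n) x - u n x))\<^sup>2) \<partial>lborel) =
        ennreal (2 ^ n) * ennreal (\<integral>x. (norm (u (Suc n) x - u n x))\<^sup>2 \<partial>lborel)"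
      by (simp add: nn_integral_cmult nn_integral_norm_square[OF sq_integrable_diff[OF u u]])
    also have "\<dots> \<le> ennreal (2 ^ n * (1 / 4) ^ n)"
      using fast[of n] by (subst ennreal_mult[symmetric]) (auto intro!: ennreal_leI)
    also have "(2::real) ^ n * (1 / 4) ^ n = (1 / 2) ^ n"
      by (subst power_mult_distrib[symmetric]) simp
    finally show "(\<integral>\<^sup>+x. ennreal (2 ^ n) * ennreal ((norm (u (Suc n) x - u n x))\<^sup>2) \<partial>lborel) \<le> ennreal ((1 / 2) ^ n)" .
  qed auto
  also have "\<dots> = ennreal (\<Sum>n. (1 / 2) ^ n)"
    by (intro suminf_ennreal2) auto
  also have "\<dots> < \<infinity>" by simp
  finally have "AE x in lborel. (\<Sum>n. ennreal (2 ^ n) * ennreal ((norm (u (Suc n) x - u n x))\<^sup>2)) \<noteq> \<infinity>"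
    by (intro nn_integral_PInf_AE) auto
  then show ?thesis
  proof eventually_elim
    case (elim x)
    let ?a = "\<lambda>n. norm (u (Suc n) x - u n x)"
    have "(\<Sum>n. ennreal (2 ^ n * (?a n)\<^sup>2)) \<noteq> \<infinity>"
      using elim by (simp add: ennreal_mult)
    then have "summable (\<lambda>n. 2 ^ n * (?a n)\<^sup>2)"
      by (intro summable_suminf_not_top) auto
    then have "summable (\<lambda>n. (1 / 2) ^ n + 2 ^ n * (?a n)\<^sup>2)"
      by (intro summable_add) auto
    then have "summable ?a"
    proof (rule summable_comparison_test')
      fix n :: nat assume "n \<ge> 0"
      have "2 * ?a n \<le> 1 / 2 ^ n + 2 ^ n * (?a n)\<^sup>2"
        by (rule two_mult_le_inverse_plus) simp
      then show "norm (?a n) \<le> (1 / 2) ^ n + 2 ^ n * (?a n)\<^sup>2"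
        using norm_ge_zero[of "u (Suc n) x - u n x"]
        unfolding real_norm_def abs_norm_cancel power_one_over by linarith
    qed
    then have "summable (\<lambda>n. u (Suc n) x - u n x)"
      by (rule summable_norm_cancel)
    then have "convergent (\<lambda>n. \<Sum>i<n. u (Suc i) x - u i x)"
      by (rule summable_iff_convergent[THEN iffD1])
    then have "convergent (\<lambda>n. u n x - u 0 x)"
      by (simp only: sum_lessThan_telescope[of "\<lambda>n. u n x"])
    then have "convergent (\<lambda>n. (u n x - u 0 x) + u 0 x)"
      by (intro convergent_add convergent_const)
    then show ?case by simp
  qed
qed

lemma LIMSEQ_of_fast_subsequence:
  fixes X :: "nat \<Rightarrow> 'a::metric_space"
  assumes M: "\<And>n m k. m \<ge> M n \<Longrightarrow> k \<ge> M n \<Longrightarrow> dist (X m) (X k) < (1 / 2) ^ n"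
    and r: "\<And>n. M n \<le> r n" and lim: "\<And>n. dist L (X (r n)) \<le> (1 / 2) ^ n"
  shows "X \<longlonglongrightarrow> L"
proof (rule metric_LIMSEQ_I)
  fix e :: real assume "e > 0"
  then have "e / 2 > 0" by simp
  then obtain n where n: "(1 / 2) ^ n < e / 2"
    using real_arch_pow_inv[of "e / 2" "1 / 2"] by auto
  have "dist (X m) L < e" if m: "m \<ge> M n" for m
    using dist_triangle2[of "X m" L "X (r n)"] M[OF m r] lim[of n] n by linarith
  then show "\<exists>no. \<forall>m\<ge>no. dist (X m) L < e" by blast
qed

instance l2_quat :: complete_space
proof
  fix X :: "nat \<Rightarrow> l2_quat" assume X: "Cauchy X"
  have "\<exists>M. \<forall>m\<ge>M. \<forall>k\<ge>M. dist (X m) (X k) < (1 / 2) ^ n" for n :: nat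
    by (rule metric_CauchyD[OF X]) simp
  then obtain M where M: "\<And>n m k. m \<ge> M n \<Longrightarrow> k \<ge> M n \<Longrightarrow> dist (X m) (X k) < (1 / 2) ^ n"
    by metis
  have quarter: "((1 / 2) ^ n)\<^sup>2 = (1 / 4 :: real) ^ n" for n
    unfolding power2_eq_square by (subst power_mult_distrib[symmetric]) simp
  \<comment> \<open>The maximum gives \<open>M n \<le> r m\<close> for all n \<le> m, so
    \<open>X (r m)\<close> and \<open>X (r n)\<close> are within (1/2)^n of each other.\<close>
  define r where "r = (\<lambda>n. Max (M ` {..n}))"
  have r: "M n \<le> r m" if "n \<le> m" for n m
    unfolding r_def using that by (intro Max_ge) auto
  have "\<exists>f. X (r n) = abs_l2_quat f \<and> sq_integrable f" for n
    by (rule l2_quat_cases[of "X (r n)"]) blast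
  then have "\<exists>u. \<forall>n. X (r n) = abs_l2_quat (u n) \<and> sq_integrable (u n)"
    by (intro choice allI)
  then obtain u where u: "\<And>n. X (r n) = abs_l2_quat (u n)" "\<And>n. sq_integrable (u n)"
    by blast
  have [measurable]: "u n \<in> borel_measurable borel" for n using u(2) by (rule sq_integrable_measurable)
  have close: "(\<integral>x. (norm (u m x - u n x))\<^sup>2 \<partial>lborel) \<le> (1 / 4) ^ n" if "n \<le> m" for n m
  proof -
    have "(\<integral>x. (norm (u m x - u n x))\<^sup>2 \<partial>lborel) = (dist (X (r m)) (X (r n)))\<^sup>2"
      by (simp add: dist_norm u l2_quat_abs_diff norm_l2_quat_abs sq_integrable_diff)
    also have "\<dots> \<le> ((1 / 2) ^ n)\<^sup>2"
      using less_imp_le[OF M[OF r[OF that] r[OF order_refl]]] by (intro power_mono) simp_all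
    also have "\<dots> = (1 / 4) ^ n" by (rule quarter)
    finally show ?thesis .
  qed
  \<comment> \<open>Where the sequence diverges \<open>lim\<close> is an unspecified value; this
    happens only on a null set.\<close>
  define g where "g = (\<lambda>x. lim (\<lambda>n. u n x))"
  have [measurable]: "g \<in> borel_measurable borel" unfolding g_def by measurable
  have AE_lim: "AE x in lborel. (\<lambda>n. u n x) \<longlonglongrightarrow> g x"
    using AE_convergent_of_fast_Cauchy[of u, OF u(2) close[OF le_SucI[OF order_refl]]]
    by eventually_elim (simp add: g_def convergent_LIMSEQ_iff)
  \<comment> \<open>Fatou in m with n fixed yields both that g is square integrable and the rate of
    convergence.\<close>
  have fatou: "(\<integral>\<^sup>+x. ennreal ((norm (g x - u n x))\<^sup>2) \<partial>lborel) \<le> ennreal ((1 / 4) ^ n)" for n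
  proof -
    have "(\<integral>\<^sup>+x. ennreal ((norm (g x - u n x))\<^sup>2) \<partial>lborel) =
        (\<integral>\<^sup>+x. liminf (\<lambda>m. ennreal ((norm (u m x - u n x))\<^sup>2)) \<partial>lborel)"
    proof (rule nn_integral_cong_AE)
      show "AE x in lborel. ennreal ((norm (g x - u n x))\<^sup>2) = liminf (\<lambda>m. ennreal ((norm (u m x - u n x))\<^sup>2))"
        using AE_lim
      proof eventually_elim
        case (elim x)
        then have "(\<lambda>m. ennreal ((norm (u m x - u n x))\<^sup>2)) \<longlonglongrightarrow> ennreal ((norm (g x - u n x))\<^sup>2)"
          by (intro tendsto_ennrealI tendsto_intros)
        then show ?case by (intro lim_imp_Liminf[symmetric]) auto
      qed
    qed
    also have "\<dots> \<le> liminf (\<lambda>m. \<integral>\<^sup>+x. ennreal ((norm (u m x - u n x))\<^sup>2) \<partial>lborel)"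
      by (rule nn_integral_liminf) measurable
    also have "\<dots> \<le> liminf (\<lambda>m. ennreal ((1 / 4) ^ n))"
    proof (rule Liminf_mono)
      show "\<forall>\<^sub>F m in sequentially. (\<integral>\<^sup>+x. ennreal ((norm (u m x - u n x))\<^sup>2) \<partial>lborel) \<le> ennreal ((1 / 4) ^ n)"
        using eventually_ge_at_top[of n]
        by eventually_elim
          (simp only: nn_integral_norm_square[OF sq_integrable_diff[OF u(2) u(2)]], intro ennreal_leI close)
    qed
    also have "\<dots> = ennreal ((1 / 4) ^ n)" by (intro Liminf_const) simp
    finally show ?thesis .
  qed
  have gu: "sq_integrable (\<lambda>x. g x - u n x)" for n
  proof -
    have "integrable lborel (\<lambda>x. (norm (g x - u n x))\<^sup>2)"
      by (rule integrableI_nonneg) (auto intro: le_less_trans[OF fatou])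
    then show ?thesis by (simp add: sq_integrable_def)
  qed
  have g: "sq_integrable g"
    using sq_integrable_add[OF gu[of 0] u(2)[of 0]] by simp
  have lim: "dist (abs_l2_quat g) (X (r n)) \<le> (1 / 2) ^ n" for n
  proof -
    have "(dist (abs_l2_quat g) (X (r n)))\<^sup>2 = (\<integral>x. (norm (g x - u n x))\<^sup>2 \<partial>lborel)"
      by (simp add: dist_norm u l2_quat_abs_diff norm_l2_quat_abs gu g)
    also have "\<dots> \<le> (1 / 4) ^ n"
      using fatou[of n] unfolding nn_integral_norm_square[OF gu] by (simp only: ennreal_le_iff zero_le_power zero_le_divide_1_iff zero_le_numeral)
    also have "\<dots> = ((1 / 2) ^ n)\<^sup>2"
      by (rule quarter[symmetric])
    finally show ?thesis
      by (rule power2_le_imp_le) (intro zero_le_power, simp)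
  qed
  have "X \<longlonglongrightarrow> abs_l2_quat g"
    by (rule LIMSEQ_of_fast_subsequence[OF M r[OF order_refl] lim])
  then show "convergent X" by (auto simp: convergent_def)
qed

section \<open>The representation\<close>

lemma qinner_abs:
  "sq_integrable f \<Longrightarrow> sq_integrable g \<Longrightarrow>
    qinner (abs_l2_quat f) (abs_l2_quat g) = (\<integral>x. quat_cnj (f x) * g x \<partial>lborel)"
  by (simp add: qinner.abs_eq l2_eq_def)

lemma abs_l2_quat_eq_0:
  assumes f: "sq_integrable f" and "AE x in lborel. f x = 0"
  shows "abs_l2_quat f = 0"
proof -
  have [measurable]: "f \<in> borel_measurable borel" using f by (rule sq_integrable_measurable)
  have "(\<integral>x. (norm (f x))\<^sup>2 \<partial>lborel) = (\<integral>x. 0 \<partial>(lborel::quat measure))"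
    using assms(2) by (intro integral_cong_AE) auto
  then have "(norm (abs_l2_quat f))\<^sup>2 = 0" by (simp add: norm_l2_quat_abs[OF f])
  then show ?thesis by simp
qed

lemma sq_integrable_U_aff:
  "sq_integrable f \<Longrightarrow> a \<noteq> 0 \<Longrightarrow> sq_integrable (\<lambda>x. (1 / (norm a)\<^sup>2) *\<^sub>R f (inverse a * (x - b)))"
  by (intro sq_integrable_scaleR sq_integrable_affine)

lemma U_aff_abs:
  "sq_integrable f \<Longrightarrow>
    U_aff (b, a) (abs_l2_quat f) = abs_l2_quat (\<lambda>x. (1 / (norm a)\<^sup>2) *\<^sub>R f (inverse a * (x - b)))"
  by (simp add: U_aff.abs_eq l2_eq_def)

lemma right_linear_U_aff:
  assumes a: "a \<noteq> 0"
  shows "right_linear (U_aff (b, a))"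
  unfolding right_linear_def
proof (intro conjI allI)
  fix F G q
  obtain f where f: "F = abs_l2_quat f" "sq_integrable f" by (rule l2_quat_cases)
  obtain g where g: "G = abs_l2_quat g" "sq_integrable g" by (rule l2_quat_cases)
  note sq = sq_integrable_U_aff[OF _ a] sq_integrable_add sq_integrable_mult_right
  have eq: "sq_integrable h \<Longrightarrow> l2_eq h h" for h by (simp add: l2_eq_def)
  show "U_aff (b, a) (F + G) = U_aff (b, a) F + U_aff (b, a) G"
    by (simp add: f g plus_l2_quat.abs_eq eq U_aff_abs sq scaleR_add_right)
  show "U_aff (b, a) (rscale F q) = rscale (U_aff (b, a) F) q"
    by (simp add: f rscale.abs_eq eq U_aff_abs sq)
qed

text \<open>The two prefactors multiply to |a|^-4, the inverse of the Jacobian in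
  \<open>distr_lborel_quat_affine\<close>: the exponent 2 is half the real dimension of the
  quaternions.\<close>

lemma qinner_U_aff:
  assumes a: "a \<noteq> 0"
  shows "qinner (U_aff (b, a) F) (U_aff (b, a) G) = qinner F G"
proof -
  obtain f where f: "F = abs_l2_quat f" "sq_integrable f" by (rule l2_quat_cases)
  obtain g where g: "G = abs_l2_quat g" "sq_integrable g" by (rule l2_quat_cases)
  have [measurable]: "f \<in> borel_measurable borel" "g \<in> borel_measurable borel"
    using f g by (auto intro: sq_integrable_measurable)
  have cnj: "quat_cnj (r *\<^sub>R x) = r *\<^sub>R quat_cnj x" for r x
    by (simp add: quat_eq_iff)
  have "qinner (U_aff (b, a) F) (U_aff (b, a) G) =
      (\<integral>x. (1 / norm a ^ 4) *\<^sub>R (quat_cnj (f (inverse a * (x - b))) * g (inverse a * (x - b))) \<partial>lborel)"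
    unfolding f(1) g(1) U_aff_abs[OF f(2)] U_aff_abs[OF g(2)]
      qinner_abs[OF sq_integrable_U_aff[OF f(2) a] sq_integrable_U_aff[OF g(2) a]]
    by (simp add: cnj power4_eq_xxxx power2_eq_square)
  also have "\<dots> = (1 / norm a ^ 4) *\<^sub>R (\<integral>x. quat_cnj (f x) * g x \<partial>distr lborel borel (\<lambda>x. inverse a * (x - b)))"
    by (subst integral_distr) auto
  also have "\<dots> = qinner F G"
    unfolding distr_lborel_quat_affine[OF a] using a
    by (subst integral_density) (auto simp: f g qinner_abs)
  finally show ?thesis .
qed

lemma U_aff_one: "U_aff (0, 1) F = F"
proof -
  obtain f where f: "F = abs_l2_quat f" "sq_integrable f" by (rule l2_quat_cases)
  then show ?thesis by (simp add: U_aff_abs)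
qed

lemma U_aff_mult:
  assumes a: "a \<noteq> 0" "a' \<noteq> 0"
  shows "U_aff (b + a * b', a * a') F = U_aff (b, a) (U_aff (b', a') F)"
proof -
  obtain f where f: "F = abs_l2_quat f" "sq_integrable f" by (rule l2_quat_cases)
  have "inverse (a * a') * (x - (b + a * b')) = inverse a' * (inverse a * (x - b) - b')" for x
  proof -
    have "inverse a * (a * b') = b'" using a by (simp flip: mult.assoc)
    then have "inverse a * (x - (b + a * b')) = inverse a * (x - b) - b'"
      by (simp add: algebra_simps)
    then show ?thesis
      using a by (simp add: nonzero_inverse_mult_distrib mult.assoc)
  qed
  then show ?thesis
    using a by (simp add: f U_aff_abs sq_integrable_U_aff norm_mult power_mult_distrib)
qed

lemma unitary_op_U_aff:
  assumes a: "a \<noteq> 0"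
  shows "unitary_op (U_aff (b, a))"
proof -
  let ?V = "U_aff (- (inverse a * b), inverse a)"
  have "a * (inverse a * b) = b" using a by (simp flip: mult.assoc)
  then have "U_aff (b, a) (?V F) = F" "?V (U_aff (b, a) F) = F" for F
    using a U_aff_mult[of a "inverse a" b "- (inverse a * b)" F] U_aff_mult[of "inverse a" a "- (inverse a * b)" b F]
    by (simp_all add: U_aff_one)
  then have "bij (U_aff (b, a))"
    by (intro o_bij[of ?V]) (simp_all add: fun_eq_iff)
  then show ?thesis
    by (simp add: unitary_op_def right_linear_U_aff qinner_U_aff a)
qed

lemma unitary_representation_U_aff: "unitary_representation quat_aff U_aff"
  unfolding unitary_representation_def
  by (auto simp: group_quat_aff unitary_op_U_aff U_aff_one U_aff_mult fun_eq_iff)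

lemma orthogonal_to_orbit_imp_zero:
  assumes F: "F \<noteq> 0" and orth: "\<And>g. g \<in> carrier quat_aff \<Longrightarrow> qinner (U_aff g F) F' = 0"
  shows "F' = 0"
proof -
  obtain f where f: "F = abs_l2_quat f" "sq_integrable f" by (rule l2_quat_cases)
  obtain f' where f': "F' = abs_l2_quat f'" "sq_integrable f'" by (rule l2_quat_cases)
  have "(\<integral>y. quat_cnj (f (p - c * y)) * f' y \<partial>lborel) = 0" if c: "c \<noteq> 0" for c p
  proof -
    \<comment> \<open>Solving \<open>inverse a * (y - b) = p - c * y\<close> for the group element:
      every slope c \<noteq> 0 and every offset p occurs.\<close>
    define a b where "a = - inverse c" and "b = inverse c * p"
    have a: "a \<noteq> 0" using c by (simp add: a_def)
    have ab: "inverse a * (y - b) = p - c * y" for y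
      using c by (simp add: a_def b_def right_diff_distrib mult.assoc[symmetric])
    have cnj: "quat_cnj (r *\<^sub>R x) = r *\<^sub>R quat_cnj x" for r x
      by (simp add: quat_eq_iff)
    have "qinner (U_aff (b, a) F) F' = (1 / (norm a)\<^sup>2) *\<^sub>R (\<integral>y. quat_cnj (f (p - c * y)) * f' y \<partial>lborel)"
      unfolding f(1) f'(1) U_aff_abs[OF f(2)] qinner_abs[OF sq_integrable_U_aff[OF f(2) a] f'(2)]
      by (simp add: ab cnj)
    then show ?thesis using orth[of "(b, a)"] a by simp
  qed
  then have "(AE x in lborel. f x = 0) \<or> (AE x in lborel. f' x = 0)"
    by (intro AE_zero_of_line_integrals_zero f f')
  then show ?thesis
    using F abs_l2_quat_eq_0[OF f(2)] abs_l2_quat_eq_0[OF f'(2)] by (auto simp: f f')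
qed

section \<open>From orthogonality to cyclic vectors and irreducibility\<close>

lemma rscale_of_real: "rscale F (r *\<^sub>R 1) = r *\<^sub>R F"
proof -
  obtain f where f: "F = abs_l2_quat f" "sq_integrable f" by (rule l2_quat_cases)
  then show ?thesis by (simp add: rscale.abs_eq scaleR_l2_quat.abs_eq l2_eq_def)
qed

lemma qinner_rscale_left: "qinner (rscale F q) G = quat_cnj q * qinner F G"
proof -
  obtain f where f: "F = abs_l2_quat f" "sq_integrable f" by (rule l2_quat_cases)
  obtain g where g: "G = abs_l2_quat g" "sq_integrable g" by (rule l2_quat_cases)
  have "quat_cnj (x * q) = quat_cnj q * quat_cnj x" for x
    by (simp add: quat_eq_iff algebra_simps)
  then show ?thesis
    using f g sq_integrable_mult_right[OF f(2), of q]
      Bochner_Integration.integral_mult_right[OF sq_integrable_inner[OF f(2) g(2)], of "quat_cnj q"]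
    by (simp add: rscale.abs_eq l2_eq_def qinner_abs mult.assoc)
qed

text \<open>S is also a real subspace, so the projection argument gives orthogonality for the real
  part of the inner product; stability under right scalars upgrades it to the quaternionic
  one.\<close>

lemma right_subspace_orthogonal:
  assumes S: "closed S" "right_subspace S" "S \<noteq> UNIV"
  obtains H where "H \<noteq> 0" "\<And>F. F \<in> S \<Longrightarrow> qinner F H = 0"
proof -
  have "subspace S"
    using S(2) unfolding right_subspace_def by (intro subspaceI) (auto simp flip: rscale_of_real)
  moreover obtain G where "G \<notin> S" using S(3) by blast
  ultimately obtain H where H: "H \<noteq> 0" "\<And>F. F \<in> S \<Longrightarrow> inner F H = 0"
    using closed_subspace_orthogonal_complement_nontrivial[OF S(1)] by blast
  have "qinner F H = 0" if "F \<in> S" for F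
  proof -
    \<comment> \<open>With the scalar q = (F | H), the real part of (F q | H) is that of
      \<open>quat_cnj q * q\<close>, namely |q|^2.\<close>
    have "rscale F (qinner F H) \<in> S" using that S(2) by (auto simp: right_subspace_def)
    then have "quat_re (qinner (rscale F (qinner F H)) H) = 0"
      using H(2) unfolding inner_l2_quat_def by blast
    then have "inner (qinner F H) (qinner F H) = 0"
      unfolding qinner_rscale_left quat_re_cnj_times .
    then show ?thesis by simp
  qed
  then show ?thesis using that H(1) by blast
qed

lemma cyclic_vector_U_aff:
  assumes "F \<noteq> 0"
  shows "cyclic_vector quat_aff U_aff F"
  unfolding cyclic_vector_def
proof (intro allI impI, elim conjE)
  fix S assume S: "closed S" "right_subspace S" "\<forall>g\<in>carrier quat_aff. U_aff g F \<in> S"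
  show "S = UNIV"
  proof (rule ccontr)
    assume "S \<noteq> UNIV"
    then obtain H where "H \<noteq> 0" "\<And>E. E \<in> S \<Longrightarrow> qinner E H = 0"
      using right_subspace_orthogonal S by blast
    then show False using orthogonal_to_orbit_imp_zero[OF assms] S(3) by blast
  qed
qed

lemma irreducible_representation_U_aff: "irreducible_representation quat_aff U_aff"
  unfolding irreducible_representation_def
proof (intro allI impI, elim conjE)
  fix S assume S: "closed S" "right_subspace S" "\<forall>g\<in>carrier quat_aff. U_aff g ` S \<subseteq> S"
  show "S = {0} \<or> S = UNIV"
  proof (cases "S \<subseteq> {0}")
    case True
    then show ?thesis using S(2) by (auto simp: right_subspace_def)
  next
    case False
    then obtain F where "F \<in> S" "F \<noteq> 0" by blast
    then show ?thesis using cyclic_vector_U_aff[of F] S unfolding cyclic_vector_def by blast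
  qed
qed

theorem mainTheorem2:
  shows "unitary_representation quat_aff U_aff
       \<and> irreducible_representation quat_aff U_aff
       \<and> (\<forall>F. F \<noteq> 0 \<longrightarrow> cyclic_vector quat_aff U_aff F)
       \<and> (\<forall>F F'. F \<noteq> 0 \<and> (\<forall>g\<in>carrier quat_aff. qinner (U_aff g F) F' = 0) \<longrightarrow> F' = 0)"
  using unitary_representation_U_aff irreducible_representation_U_aff cyclic_vector_U_aff
    orthogonal_to_orbit_imp_zero by blast

end
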